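(* Let $\Omega$ be a bounded domain in $\mathbb{R}^m$. Let $\vec F=(F_1,\dots,F_m)\in W^1(\Omega)\cap L^1(\Omega)$ be a vector field and $H\in L^\infty(\Omega)$ a real function. Let $u, v\in W^{2,1}(\Omega)$ be two minimizers for $\mathcal{F}_H(\cdot)$ in $W^{1,1}(\Omega)$ with $u-v\in W_0^{2,1}(\Omega)$. Suppose that for some constant $C>0$, $|\nabla u+\vec F|\ge C$ and $|\nabla v+\vec F|\ge C$ (a.e.). Suppose $m\ge\operatorname{rank}(h_{IJ})\ge 3$ in $\Omega$ (a.e.). Then $u=v$ in $\Omega$ (a.e.).
   Context: $W^1(\Omega)$ denotes the space of weakly differentiable functions on $\Omega$ (locally integrable functions whose first weak derivatives exist as locally integrable functions), applied componentwise for vector fields. The generalized $p$-area is $\mathcal{F}_H(u) := \int_\Omega \{|\nabla u+\vec F| + Hu\}\,dx^1\wedge\cdots\wedge dx^m$ for $u\in W^{1,1}(\Omega)$. A function $u\in W^{1,1}(\Omega)$ is a minimizer for $\mathcal{F}_H$ in $W^{1,1}(\Omega)$ if $\mathcal{F}_H(u)\le\mathcal{F}_H(u+\varphi)$ for every $\varphi\in W_0^{1,1}(\Omega)$. $h_{IJ} := \partial_I F_J-\partial_J F_I$ (weak derivatives) for $1\le I,J\le m$, regarded as an $m\times m$ matrix. The integer $m$ need not be even. *)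

theory Defs
  imports "HOL-Analysis.Analysis"
begin

text \<open>
  Functions on \<open>\<Omega> \<subseteq> \<real>\<^sup>m\<close> are total functions on \<^typ>\<open>real ^ 'm\<close> whose values
  outside \<open>\<Omega>\<close> are irrelevant; elements of the function spaces are representatives, so equality
  in these spaces is equality almost everywhere on \<open>\<Omega>\<close>.
\<close>

subsection \<open>Test functions\<close>

definition partial_deriv :: "'m::finite \<Rightarrow> (real ^ 'm \<Rightarrow> real) \<Rightarrow> real ^ 'm \<Rightarrow> real" where
  "partial_deriv i f x = frechet_derivative f (at x) (axis i 1)"

text \<open>A list of directions plays the role of a multi-index; its length is the order.\<close>

primrec partial_derivs :: "'m::finite list \<Rightarrow> (real ^ 'm \<Rightarrow> real) \<Rightarrow> real ^ 'm \<Rightarrow> real" where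
  "partial_derivs [] f = f"
| "partial_derivs (i # is) f = partial_deriv i (partial_derivs is f)"

text \<open>\<open>C\<^sub>c\<^sup>\<infinity>(\<Omega>)\<close>, extended by zero to the whole space.\<close>

definition test_functions :: "(real ^ 'm::finite) set \<Rightarrow> (real ^ 'm \<Rightarrow> real) set" where
  "test_functions \<Omega> = {\<phi>. (\<forall>is x. partial_derivs is \<phi> differentiable (at x)) \<and>
     compact (closure {x. \<phi> x \<noteq> 0}) \<and> closure {x. \<phi> x \<noteq> 0} \<subseteq> \<Omega>}"

subsection \<open>Lebesgue and Sobolev spaces\<close>

definition L1_space :: "(real ^ 'm::finite) set \<Rightarrow> (real ^ 'm \<Rightarrow> real) set" where
  "L1_space \<Omega> = {f. f absolutely_integrable_on \<Omega>}"

definition L1_loc :: "(real ^ 'm::finite) set \<Rightarrow> (real ^ 'm \<Rightarrow> real) set" where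
  "L1_loc \<Omega> = {f. \<forall>K. compact K \<and> K \<subseteq> \<Omega> \<longrightarrow> f absolutely_integrable_on K}"

definition Linf_space :: "(real ^ 'm::finite) set \<Rightarrow> (real ^ 'm \<Rightarrow> real) set" where
  "Linf_space \<Omega> = {f. f \<in> borel_measurable (lebesgue_on \<Omega>) \<and>
     (\<exists>B. AE x in lebesgue_on \<Omega>. \<bar>f x\<bar> \<le> B)}"

definition has_weak_deriv ::
    "(real ^ 'm::finite) set \<Rightarrow> 'm list \<Rightarrow> (real ^ 'm \<Rightarrow> real) \<Rightarrow> (real ^ 'm \<Rightarrow> real) \<Rightarrow> bool" where
  "has_weak_deriv \<Omega> is u g \<longleftrightarrow> u \<in> L1_loc \<Omega> \<and> g \<in> L1_loc \<Omega> \<and>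
     (\<forall>\<phi>\<in>test_functions \<Omega>.
        (LINT x:\<Omega>|lebesgue. u x * partial_derivs is \<phi> x) =
        (-1) ^ length is * (LINT x:\<Omega>|lebesgue. g x * \<phi> x))"

text \<open>A representative of the weak derivative (unique up to null sets when it exists).\<close>

definition weak_deriv ::
    "(real ^ 'm::finite) set \<Rightarrow> 'm list \<Rightarrow> (real ^ 'm \<Rightarrow> real) \<Rightarrow> real ^ 'm \<Rightarrow> real" where
  "weak_deriv \<Omega> is u = (SOME g. has_weak_deriv \<Omega> is u g)"

definition weak_grad :: "(real ^ 'm::finite) set \<Rightarrow> (real ^ 'm \<Rightarrow> real) \<Rightarrow> real ^ 'm \<Rightarrow> real ^ 'm" where
  "weak_grad \<Omega> u x = (\<chi> i. weak_deriv \<Omega> [i] u x)"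

text \<open>\<open>W\<^sup>k(\<Omega>)\<close>: the \<open>k\<close> times weakly differentiable functions.\<close>

definition W_space :: "nat \<Rightarrow> (real ^ 'm::finite) set \<Rightarrow> (real ^ 'm \<Rightarrow> real) set" where
  "W_space k \<Omega> = {u \<in> L1_loc \<Omega>. \<forall>is. length is \<le> k \<longrightarrow> (\<exists>g. has_weak_deriv \<Omega> is u g)}"

text \<open>\<open>W\<^bsup>k,1\<^esup>(\<Omega>)\<close>\<close>

definition W1_space :: "nat \<Rightarrow> (real ^ 'm::finite) set \<Rightarrow> (real ^ 'm \<Rightarrow> real) set" where
  "W1_space k \<Omega> = {u \<in> W_space k \<Omega>. \<forall>is. length is \<le> k \<longrightarrow> weak_deriv \<Omega> is u \<in> L1_space \<Omega>}"

text \<open>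
  \<open>W\<^sub>0\<^bsup>k,1\<^esup>(\<Omega>)\<close>: the closure of \<open>C\<^sub>c\<^sup>\<infinity>(\<Omega>)\<close> in \<open>W\<^bsup>k,1\<^esup>(\<Omega>)\<close>. Convergence in the Sobolev norm is
  \<open>L\<^sup>1\<close>-convergence of each of the finitely many derivatives of order at most \<open>k\<close>.
\<close>

definition W1_0_space :: "nat \<Rightarrow> (real ^ 'm::finite) set \<Rightarrow> (real ^ 'm \<Rightarrow> real) set" where
  "W1_0_space k \<Omega> = {u \<in> W1_space k \<Omega>. \<exists>\<phi>. (\<forall>n::nat. \<phi> n \<in> test_functions \<Omega>) \<and>
     (\<forall>is. length is \<le> k \<longrightarrow>
        (\<lambda>n. LINT x:\<Omega>|lebesgue. \<bar>partial_derivs is (\<phi> n) x - weak_deriv \<Omega> is u x\<bar>)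
          \<longlonglongrightarrow> 0)}"

subsection \<open>The generalized \<open>p\<close>-area\<close>

definition p_area ::
    "(real ^ 'm::finite) set \<Rightarrow> (real ^ 'm \<Rightarrow> real ^ 'm) \<Rightarrow> (real ^ 'm \<Rightarrow> real) \<Rightarrow>
     (real ^ 'm \<Rightarrow> real) \<Rightarrow> real" where
  "p_area \<Omega> F H u = (LINT x:\<Omega>|lebesgue. norm (weak_grad \<Omega> u x + F x) + H x * u x)"

definition p_area_minimizer ::
    "(real ^ 'm::finite) set \<Rightarrow> (real ^ 'm \<Rightarrow> real ^ 'm) \<Rightarrow> (real ^ 'm \<Rightarrow> real) \<Rightarrow>
     (real ^ 'm \<Rightarrow> real) \<Rightarrow> bool" where
  "p_area_minimizer \<Omega> F H u \<longleftrightarrow> u \<in> W1_space 1 \<Omega> \<and>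
     (\<forall>\<phi>\<in>W1_0_space 1 \<Omega>. p_area \<Omega> F H u \<le> p_area \<Omega> F H (\<lambda>x. u x + \<phi> x))"

definition curl_matrix ::
    "(real ^ 'm::finite) set \<Rightarrow> (real ^ 'm \<Rightarrow> real ^ 'm) \<Rightarrow> real ^ 'm \<Rightarrow> real ^ 'm ^ 'm" where
  "curl_matrix \<Omega> F x =
     (\<chi> I J. weak_deriv \<Omega> [I] (\<lambda>y. F y $ J) x - weak_deriv \<Omega> [J] (\<lambda>y. F y $ I) x)"

end

theory Submission imports Defs begin

text \<open>
  Put \<open>\<alpha> = \<nabla>u + F\<close>, \<open>\<beta> = \<nabla>v + F\<close> and \<open>w = u - v\<close>. The integrand of the generalized \<open>p\<close>-area is convex in
  the gradient and affine in \<open>u\<close>. Comparing both minimizers with their midpoint \<open>(u + v) / 2\<close>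
  therefore forces equality in the triangle inequality,
  \<open>\<bar>\<alpha>\<bar> + \<bar>\<beta>\<bar> = \<bar>\<alpha> + \<beta>\<bar>\<close> almost everywhere (\<open>minimizers_gradients_parallel\<close>), so that \<open>\<alpha>\<close> and \<open>\<beta>\<close> are
  parallel. Since \<open>\<beta> = \<alpha> - \<nabla>w\<close>, this says \<open>\<alpha>\<^sub>i \<partial>\<^sub>jw = \<alpha>\<^sub>j \<partial>\<^sub>iw\<close>, that is \<open>\<alpha> \<and> dw = 0\<close>.

  Taking the exterior derivative of \<open>\<alpha> \<and> dw = 0\<close> gives \<open>d\<alpha> \<and> dw = 0\<close>, and \<open>d\<alpha> = dF\<close> is the curl matrix \<open>h\<close>.
  In coordinates, \<open>h\<^sub>i\<^sub>j \<partial>\<^sub>kw + h\<^sub>j\<^sub>k \<partial>\<^sub>iw + h\<^sub>k\<^sub>i \<partial>\<^sub>jw = 0\<close>. At a point where \<open>\<nabla>w \<noteq> 0\<close> this makes every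
  row of \<open>h\<close> a combination of two fixed vectors, so \<open>h\<close> has rank at most 2
  (\<open>rank_le_2_of_cyclic_relation\<close>). As the rank is at least 3, \<open>\<nabla>w = 0\<close> almost everywhere, and the
  Poincare inequality, applied to test functions approximating \<open>w\<close>, yields \<open>w = 0\<close>
  (\<open>W1_0_space_eq_0\<close>).

  The delicate point is the differentiation: a product of two functions with integrable weak
  derivatives need not be locally integrable, so a Leibniz rule for weak derivatives of products is not
  available. It does hold pointwise: the difference quotients
  of a weakly differentiable function along a coordinate direction, with steps \<open>1 / (n + 1)\<close>, converge
  to the weak derivative almost everywhere (\<open>weak_deriv_difference_quotient\<close>). An identity
  between products that holds almost everywhere is hence inherited by the difference quotients and,
  in the limit, by the derivatives (\<open>weak_deriv_of_equal_products\<close>).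

  Convergence of the difference quotients follows from the formula
  \<open>f (x + h e) - f x = \<integral>\<^sub>0\<^sup>h g (x + t e) dt\<close> for almost every \<open>x\<close>, where \<open>g\<close> is the weak derivative,
  together with one-dimensional Lebesgue differentiation on lines and Fubini's theorem. The
  formula itself is checked against test functions, and so rests on the fundamental lemma of the
  calculus of variations, for which sufficiently many smooth bump functions are constructed first.
\<close>

section \<open>Smooth bump functions on boxes\<close>

text \<open>
  The family \<open>t\<^sup>-\<^sup>k exp (- 1 / t)\<close> is closed under differentiation up to linear combinations, so
  carrying the exponent \<open>k\<close> along replaces an induction over higher derivatives.
\<close>

definition flat_exp :: "nat \<Rightarrow> real \<Rightarrow> real" where
  "flat_exp k t = (if t > 0 then (1 / t) ^ k * exp (- 1 / t) else 0)"

lemma flat_exp_tendsto_0: "(flat_exp k \<longlongrightarrow> 0) (at 0)"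
proof -
  have "((\<lambda>t::real. (inverse t) ^ k / exp (inverse t)) \<longlongrightarrow> 0) (at_right 0)"
    using filterlim_compose[OF tendsto_power_div_exp_0 filterlim_inverse_at_top_right] .
  then have "(flat_exp k \<longlongrightarrow> 0) (at_right 0)"
    by (rule Lim_transform_eventually)
       (auto simp: flat_exp_def eventually_at_filter exp_minus field_simps)
  moreover have "(flat_exp k \<longlongrightarrow> 0) (at_left 0)"
    by (rule Lim_transform_eventually[OF tendsto_const])
       (auto simp: flat_exp_def eventually_at_filter)
  ultimately show ?thesis
    by (simp add: filterlim_split_at)
qed

lemma flat_exp_has_derivative:
  "(flat_exp k has_real_derivative (flat_exp (k + 2) t - real k * flat_exp (k + 1) t)) (at t)"
proof -
  consider "t > 0" | "t < 0" | "t = 0" by linarith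
  then show ?thesis
  proof cases
    case 1
    have "((\<lambda>t. (1 / t) ^ k * exp (- 1 / t)) has_real_derivative
        (flat_exp (k + 2) t - real k * flat_exp (k + 1) t)) (at t)"
    proof -
      have inv: "((\<lambda>t. 1 / t) has_real_derivative - ((1 / t)\<^sup>2)) (at t)"
        using 1 by (auto intro!: derivative_eq_intros simp: power2_eq_square)
      have pow: "((\<lambda>t. (1 / t) ^ k) has_real_derivative - real k * (1 / t) ^ (k + 1)) (at t)"
        by (rule DERIV_cong[OF DERIV_power[OF inv, of k]])
           (cases k; simp add: power2_eq_square algebra_simps diff_divide_distrib add_divide_distrib)
      have exp: "((\<lambda>t. exp (- (1 / t))) has_real_derivative exp (- (1 / t)) * (1 / t)\<^sup>2) (at t)"
        using DERIV_fun_exp[OF DERIV_minus[OF inv]] by simp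
      show ?thesis
        using DERIV_mult[OF pow exp] 1
        by (simp add: flat_exp_def power2_eq_square algebra_simps)
    qed
    then show ?thesis
      by (rule has_field_derivative_transform_within_open[of _ _ _ "{0<..}"])
         (use 1 in \<open>auto simp: flat_exp_def\<close>)
  next
    case 2
    have "((\<lambda>t. 0) has_real_derivative 0) (at t)" by simp
    then have "(flat_exp k has_real_derivative 0) (at t)"
      by (rule has_field_derivative_transform_within_open[of _ _ _ "{..<0}"])
         (use 2 in \<open>auto simp: flat_exp_def\<close>)
    then show ?thesis using 2 by (simp add: flat_exp_def)
  next
    case 3
    have "((\<lambda>h. (flat_exp k (0 + h) - flat_exp k 0) / h) \<longlongrightarrow> 0) (at 0)"
      by (rule Lim_transform_eventually[OF flat_exp_tendsto_0[of "Suc k"]])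
         (auto simp: flat_exp_def eventually_at_filter)
    then show ?thesis
      using 3 by (simp add: DERIV_def) (simp add: flat_exp_def)
  qed
qed

lemma flat_exp_bounds: "0 \<le> flat_exp 0 t" "flat_exp 0 t \<le> 1"
  by (auto simp: flat_exp_def)

lemma flat_exp_pos_iff: "flat_exp 0 t \<noteq> 0 \<longleftrightarrow> t > 0"
  by (auto simp: flat_exp_def)

lemma flat_exp_scaled_tendsto:
  assumes "t > 0"
  shows "(\<lambda>n. flat_exp 0 (real (Suc n) * t)) \<longlonglongrightarrow> 1"
proof -
  have "(\<lambda>n. - (1 / t) * inverse (real (Suc n))) \<longlonglongrightarrow> - (1 / t) * 0"
    by (intro tendsto_intros LIMSEQ_inverse_real_of_nat)
  then have "(\<lambda>n. exp (- (1 / t) * inverse (real (Suc n)))) \<longlonglongrightarrow> exp 0"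
    by (intro tendsto_exp) simp
  moreover have "flat_exp 0 (real (Suc n) * t) = exp (- (1 / t) * inverse (real (Suc n)))" for n
  proof -
    have "real (Suc n) * t > 0" using assms by simp
    then show ?thesis using assms by (simp add: flat_exp_def field_simps)
  qed
  ultimately show ?thesis by simp
qed

text \<open>
  A class of functions that contains the bumps below and is visibly closed under partial
  derivatives, so that smoothness of its members needs no estimate for iterated derivatives.
\<close>

inductive bump_generated :: "(real ^ 'm::finite \<Rightarrow> real) \<Rightarrow> bool" where
  const: "bump_generated (\<lambda>x. c)"
| flat: "bump_generated (\<lambda>x. flat_exp k (c * x $ i + d))"
| mult: "bump_generated f \<Longrightarrow> bump_generated g \<Longrightarrow> bump_generated (\<lambda>x. f x * g x)"
| add: "bump_generated f \<Longrightarrow> bump_generated g \<Longrightarrow> bump_generated (\<lambda>x. f x + g x)"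

lemma bump_generated_derivative:
  assumes "bump_generated \<phi>"
  shows "\<exists>D. (\<forall>i. bump_generated (D i)) \<and>
           (\<forall>x. (\<phi> has_derivative (\<lambda>h. \<Sum>i\<in>UNIV. h $ i * D i x)) (at x))"
  using assms
proof induction
  case (const c)
  show ?case
    by (rule exI[of _ "\<lambda>i x. 0"]) (auto intro: bump_generated.const)
next
  case (flat k c i d)
  define D where "D = (\<lambda>j x. (if j = i then c else 0) *
      (flat_exp (k + 2) (c * x $ i + d) + (- real k) * flat_exp (k + 1) (c * x $ i + d)))"
  have D: "bump_generated (D j)" for j
    unfolding D_def by (intro bump_generated.intros)
  have "((\<lambda>x. flat_exp k (c * x $ i + d)) has_derivative (\<lambda>h. \<Sum>j\<in>UNIV. h $ j * D j x)) (at x)" for x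
  proof -
    have "((\<lambda>x. c * x $ i + d) has_derivative (\<lambda>h. c * h $ i)) (at x)"
      by (auto intro!: derivative_eq_intros bounded_linear_imp_has_derivative bounded_linear_vec_nth)
    from has_derivative_compose[OF this
        flat_exp_has_derivative[of k "c * x $ i + d", unfolded has_field_derivative_def]]
    have "((\<lambda>x. flat_exp k (c * x $ i + d)) has_derivative (\<lambda>h.
        (flat_exp (k + 2) (c * x $ i + d) - real k * flat_exp (k + 1) (c * x $ i + d)) * (c * h $ i))) (at x)"
      by simp
    moreover have "(\<Sum>j\<in>UNIV. h $ j * D j x) =
        (flat_exp (k + 2) (c * x $ i + d) - real k * flat_exp (k + 1) (c * x $ i + d)) * (c * h $ i)" for h
    proof -
      have "(\<Sum>j\<in>UNIV. h $ j * D j x) = (\<Sum>j\<in>UNIV. if j = i then h $ j * D j x else 0)"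
        by (rule sum.cong) (auto simp: D_def)
      also have "\<dots> = h $ i * D i x" by simp
      finally show ?thesis by (simp add: D_def algebra_simps)
    qed
    ultimately show ?thesis by simp
  qed
  with D show ?case by blast
next
  case (mult f g)
  from mult.IH(1) obtain D where D: "\<And>i. bump_generated (D i)"
    "\<And>x. (f has_derivative (\<lambda>h. \<Sum>i\<in>UNIV. h $ i * D i x)) (at x)"
    by auto
  from mult.IH(2) obtain E where E: "\<And>i. bump_generated (E i)"
    "\<And>x. (g has_derivative (\<lambda>h. \<Sum>i\<in>UNIV. h $ i * E i x)) (at x)"
    by auto
  have "((\<lambda>x. f x * g x) has_derivative
      (\<lambda>h. \<Sum>i\<in>UNIV. h $ i * (f x * E i x + D i x * g x))) (at x)" for x
    by (rule has_derivative_eq_rhs[OF has_derivative_mult[OF D(2) E(2)]])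
       (simp add: fun_eq_iff sum_distrib_left sum_distrib_right sum.distrib algebra_simps)
  moreover have "bump_generated (\<lambda>x. f x * E i x + D i x * g x)" for i
    by (intro bump_generated.intros mult.hyps D E)
  ultimately show ?case by (intro exI[of _ "\<lambda>i x. f x * E i x + D i x * g x"]) auto
next
  case (add f g)
  from add.IH(1) obtain D where D: "\<And>i. bump_generated (D i)"
    "\<And>x. (f has_derivative (\<lambda>h. \<Sum>i\<in>UNIV. h $ i * D i x)) (at x)"
    by auto
  from add.IH(2) obtain E where E: "\<And>i. bump_generated (E i)"
    "\<And>x. (g has_derivative (\<lambda>h. \<Sum>i\<in>UNIV. h $ i * E i x)) (at x)"
    by auto
  have "((\<lambda>x. f x + g x) has_derivative
      (\<lambda>h. \<Sum>i\<in>UNIV. h $ i * (D i x + E i x))) (at x)" for x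
    by (rule has_derivative_eq_rhs[OF has_derivative_add[OF D(2) E(2)]])
       (simp add: fun_eq_iff sum.distrib algebra_simps)
  moreover have "bump_generated (\<lambda>x. D i x + E i x)" for i
    by (intro bump_generated.intros D E)
  ultimately show ?case by (intro exI[of _ "\<lambda>i x. D i x + E i x"]) auto
qed

lemma bump_generated_partial_derivs:
  assumes "bump_generated \<phi>"
  shows "bump_generated (partial_derivs is \<phi>)"
proof (induction "is")
  case Nil
  then show ?case using assms by simp
next
  case (Cons i is')
  obtain D where D: "\<And>i. bump_generated (D i)"
    "\<And>x. (partial_derivs is' \<phi> has_derivative (\<lambda>h. \<Sum>i\<in>UNIV. h $ i * D i x)) (at x)"
    using bump_generated_derivative[OF Cons] by blast
  have "partial_deriv i (partial_derivs is' \<phi>) x = D i x" for x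
  proof -
    have "partial_deriv i (partial_derivs is' \<phi>) x = (\<Sum>j\<in>UNIV. axis i 1 $ j * D j x)"
      unfolding partial_deriv_def frechet_derivative_at[OF D(2), symmetric] ..
    also have "\<dots> = (\<Sum>j\<in>UNIV. if j = i then D j x else 0)"
      by (rule sum.cong) (auto simp: axis_def)
    finally show ?thesis by simp
  qed
  then have "partial_derivs (i # is') \<phi> = D i" by auto
  then show ?case using D(1) by simp
qed

lemma bump_generated_smooth:
  assumes "bump_generated \<phi>"
  shows "partial_derivs is \<phi> differentiable (at x)"
  using bump_generated_derivative[OF bump_generated_partial_derivs[OF assms]]
  by (meson differentiableI)

definition box_bump :: "real ^ 'm::finite \<Rightarrow> real ^ 'm \<Rightarrow> nat \<Rightarrow> real ^ 'm \<Rightarrow> real" where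
  "box_bump a b n x = (\<Prod>i\<in>UNIV. flat_exp 0 (real (Suc n) * (x $ i - a $ i)) *
                                 flat_exp 0 (real (Suc n) * (b $ i - x $ i)))"

lemma box_bump_nonzero_iff: "box_bump a b n x \<noteq> 0 \<longleftrightarrow> x \<in> box a b"
  by (auto simp: box_bump_def prod_zero_iff flat_exp_pos_iff mem_box_cart zero_less_mult_iff)

lemma box_bump_bounds: "0 \<le> box_bump a b n x" "box_bump a b n x \<le> 1"
  unfolding box_bump_def
  by (auto intro!: prod_nonneg prod_le_1 mult_nonneg_nonneg mult_le_one simp: flat_exp_bounds)

lemma box_bump_tendsto: "(\<lambda>n. box_bump a b n x) \<longlonglongrightarrow> indicator (box a b) x"
proof (cases "x \<in> box a b")
  case True
  have "(\<lambda>n. box_bump a b n x) \<longlonglongrightarrow> (\<Prod>i\<in>(UNIV::'a set). 1 * 1)"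
    unfolding box_bump_def
    by (intro tendsto_prod tendsto_mult flat_exp_scaled_tendsto)
       (use True in \<open>auto simp: mem_box_cart\<close>)
  then show ?thesis using True by simp
next
  case False
  then have "box_bump a b n x = 0" for n using box_bump_nonzero_iff[of a b n x] by blast
  then show ?thesis using False by simp
qed

lemma box_bump_generated: "bump_generated (box_bump a b n)"
proof -
  have prod: "bump_generated (\<lambda>x. \<Prod>i\<in>I. f i x)"
    if "finite I" "\<And>i. bump_generated (f i)" for I and f :: "'m \<Rightarrow> real^'m \<Rightarrow> real"
    using that by (induction I) (auto intro: bump_generated.intros)
  have 1: "bump_generated (\<lambda>x. flat_exp 0 (real (Suc n) * (x $ i - a $ i)))" for i
    using bump_generated.flat[of 0 "real (Suc n)" i "- real (Suc n) * a $ i"]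
    by (simp add: algebra_simps)
  have 2: "bump_generated (\<lambda>x. flat_exp 0 (real (Suc n) * (b $ i - x $ i)))" for i
    using bump_generated.flat[of 0 "- real (Suc n)" i "real (Suc n) * b $ i"]
    by (simp add: algebra_simps)
  show ?thesis
    unfolding box_bump_def by (intro prod bump_generated.mult 1 2) simp
qed

lemma box_bump_test_function:
  assumes "cbox a b \<subseteq> \<Omega>"
  shows "box_bump a b n \<in> test_functions \<Omega>"
proof -
  have "closure {x. box_bump a b n x \<noteq> 0} \<subseteq> cbox a b"
    by (rule closure_minimal) (auto simp: box_bump_nonzero_iff mem_box_cart less_imp_le)
  moreover from this have "compact (closure {x. box_bump a b n x \<noteq> 0})"
    using bounded_subset[OF bounded_cbox] by (auto simp: compact_eq_bounded_closed)
  ultimately show ?thesis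
    using assms bump_generated_smooth[OF box_bump_generated]
    by (auto simp: test_functions_def)
qed

section \<open>The fundamental lemma of the calculus of variations\<close>

lemma AE_lebesgue_iff: "(AE x in lebesgue. P x) \<longleftrightarrow> (AE x in lborel. P x)"
  by (rule AE_completion_iff)

lemma AE_lebesgue_on_iff:
  assumes "open \<Omega>"
  shows "(AE x in lebesgue_on \<Omega>. P x) \<longleftrightarrow> (AE x in lborel. x \<in> \<Omega> \<longrightarrow> P x)"
  using assms by (subst AE_restrict_space_iff) (auto simp: AE_lebesgue_iff)

text \<open>
  By the Lindelof property countably many of the given neighbourhoods suffice, and countably many
  null sets may be discarded.
\<close>

lemma AE_open_local:
  fixes \<Omega> :: "'a::euclidean_space set"
  assumes "\<And>x. x \<in> \<Omega> \<Longrightarrow> \<exists>U. open U \<and> x \<in> U \<and> (AE y in lborel. y \<in> U \<longrightarrow> P y)"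
  shows "AE y in lborel. y \<in> \<Omega> \<longrightarrow> P y"
proof -
  define \<U> where "\<U> = {U. open U \<and> (AE y in lborel. y \<in> U \<longrightarrow> P y)}"
  obtain \<V> where V: "\<V> \<subseteq> \<U>" "countable \<V>" "\<Union>\<V> = \<Union>\<U>"
    by (rule Lindelof[of \<U>]) (auto simp: \<U>_def)
  have "AE y in lborel. \<forall>U\<in>\<V>. y \<in> U \<longrightarrow> P y"
    using V by (subst AE_ball_countable) (auto simp: \<U>_def)
  moreover have "\<Omega> \<subseteq> \<Union>\<V>" unfolding V(3) using assms by (force simp: \<U>_def)
  ultimately show ?thesis by (auto elim!: eventually_mono)
qed

text \<open>
  The bumps of a box converge boundedly to the indicator of its interior, so the integral of \<open>f\<close> over every closed box
  inside \<open>\<Omega>\<close> vanishes. Averages over small cubes converge to \<open>f\<close> almost everywhere, hence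
  \<open>f = 0\<close>.
\<close>

lemma fundamental_lemma:
  fixes f :: "real ^ 'm::finite \<Rightarrow> real"
  assumes "open \<Omega>" "f \<in> L1_loc \<Omega>"
    and zero: "\<And>\<phi>. \<phi> \<in> test_functions \<Omega> \<Longrightarrow> (LINT x:\<Omega>|lebesgue. f x * \<phi> x) = 0"
  shows "AE x in lborel. x \<in> \<Omega> \<longrightarrow> f x = 0"
proof (rule AE_open_local)
  have ai: "f absolutely_integrable_on cbox a b" if "cbox a b \<subseteq> \<Omega>" for a b
    using assms that by (auto simp: L1_loc_def)
  have box0: "integral (cbox a b) f = 0" if ab: "cbox a b \<subseteq> \<Omega>" for a b
  proof -
    have int: "integrable lebesgue (\<lambda>x. indicator (cbox a b) x * f x)"
      using ai[OF ab] by (simp add: set_integrable_def)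
    have m: "(\<lambda>x. box_bump a b n x) \<in> borel_measurable lebesgue" for n
      using bump_generated_smooth[OF box_bump_generated[of a b n], of "[]"]
      by (intro measurable_completion)
         (auto intro!: borel_measurable_continuous_onI differentiable_imp_continuous_on
            simp: differentiable_on_def)
    have "(\<lambda>n. LINT x|lebesgue. (indicator (cbox a b) x * f x) * box_bump a b n x)
        \<longlonglongrightarrow> (LINT x|lebesgue. (indicator (cbox a b) x * f x) * indicator (box a b) x)"
    proof (rule integral_dominated_convergence)
      show "integrable lebesgue (\<lambda>x. norm (indicator (cbox a b) x * f x))"
        using int by (rule integrable_norm)
      show "(\<lambda>x. indicator (cbox a b) x * f x * indicator (box a b) x) \<in> borel_measurable lebesgue"
        by (rule borel_measurable_times[OF borel_measurable_integrable[OF int]])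
           (auto intro!: borel_measurable_indicator sets_completionI_sets)
      show "(\<lambda>x. indicator (cbox a b) x * f x * box_bump a b n x) \<in> borel_measurable lebesgue" for n
        by (rule borel_measurable_times[OF borel_measurable_integrable[OF int] m])
      show "AE x in lebesgue. (\<lambda>n. indicator (cbox a b) x * f x * box_bump a b n x)
          \<longlonglongrightarrow> indicator (cbox a b) x * f x * indicator (box a b) x"
        by (intro AE_I2 tendsto_intros box_bump_tendsto)
      show "AE x in lebesgue. norm (indicator (cbox a b) x * f x * box_bump a b n x)
          \<le> norm (indicator (cbox a b) x * f x)" for n
        using box_bump_bounds[of a b n]
        by (intro AE_I2) (auto simp: abs_mult intro!: mult_left_le)
    qed
    moreover have "(LINT x|lebesgue. (indicator (cbox a b) x * f x) * box_bump a b n x) = 0" for n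
    proof -
      have eq: "(indicator (cbox a b) x * f x) * box_bump a b n x
          = indicator \<Omega> x *\<^sub>R (f x * box_bump a b n x)" for x
        using box_bump_nonzero_iff[of a b n x] ab box_subset_cbox[of a b]
        by (auto simp: indicator_def)
      then show ?thesis
        using zero[OF box_bump_test_function[OF ab], of n] by (simp only: eq set_lebesgue_integral_def)
    qed
    ultimately have "(LINT x|lebesgue. (indicator (cbox a b) x * f x) * indicator (box a b) x) = 0"
      by (simp add: LIMSEQ_const_iff)
    moreover have "(indicator (cbox a b) x * f x) * indicator (box a b) x
        = indicator (box a b) x *\<^sub>R f x" for x
      using box_subset_cbox[of a b] by (auto simp: indicator_def)
    ultimately have "(LINT x:box a b|lebesgue. f x) = 0"
      by (simp add: set_lebesgue_integral_def)
    moreover have "f absolutely_integrable_on box a b"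
      using set_integrable_subset[OF ai[OF ab] _ box_subset_cbox] by simp
    ultimately have "integral (box a b) f = 0"
      by (simp add: set_lebesgue_integral_eq_integral)
    then show ?thesis by (simp add: integral_open_interval)
  qed
  fix x assume "x \<in> \<Omega>"
  then obtain c d where cd: "cbox c d \<subseteq> \<Omega>" "x \<in> box c d" "\<forall>i\<in>Basis. c \<bullet> i < d \<bullet> i"
    by (rule open_contains_cbox[OF assms(1)])
  define g where "g = (\<lambda>x. if x \<in> cbox c d then f x else 0)"
  have g: "g integrable_on cbox a b \<and> integral (cbox a b) g = 0" for a b
  proof -
    obtain p q where pq: "cbox a b \<inter> cbox c d = cbox p q"
      by (rule that[OF Int_interval])
    then have "cbox p q \<subseteq> \<Omega>" using cd by blast
    then have "f integrable_on cbox p q" "integral (cbox p q) f = 0"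
      using ai box0 set_lebesgue_integral_eq_integral(1) by blast+
    moreover have "(g has_integral k) (cbox a b) \<longleftrightarrow> (f has_integral k) (cbox p q)" for k
      unfolding g_def pq[symmetric] by (simp only: has_integral_restrict_Int Int_commute)
    ultimately show ?thesis
      by (metis has_integral_integrable_integral)
  qed
  obtain N where N: "negligible N" "\<And>x e. \<lbrakk>x \<notin> N; 0 < e\<rbrakk> \<Longrightarrow>
      \<exists>d>0. \<forall>h. 0 < h \<and> h < d \<longrightarrow>
        norm (integral (cbox x (x + h *\<^sub>R One)) g /\<^sub>R h ^ DIM(real^'m) - g x) < e"
    using integrable_ccontinuous_explicit[of g] g by blast
  have "g y = 0" if y: "y \<notin> N" for y
  proof (rule ccontr)
    assume "g y \<noteq> 0"
    then obtain d where d: "d > 0" "\<And>h. 0 < h \<Longrightarrow> h < d \<Longrightarrow>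
        norm (integral (cbox y (y + h *\<^sub>R One)) g /\<^sub>R h ^ DIM(real^'m) - g y) < \<bar>g y\<bar>"
      using N(2)[OF y, of "\<bar>g y\<bar>"] by auto
    from d(2)[of "d/2"] d(1) g show False by simp
  qed
  then have "AE y in lebesgue. g y = 0"
    using N(1) by (intro AE_I'[of N]) (auto simp: negligible_iff_null_sets)
  then have "AE y in lborel. y \<in> box c d \<longrightarrow> f y = 0"
    unfolding AE_lebesgue_iff g_def
    by (rule eventually_mono) (use box_subset_cbox in \<open>auto split: if_splits\<close>)
  with cd(2) show "\<exists>U. open U \<and> x \<in> U \<and> (AE y in lborel. y \<in> U \<longrightarrow> f y = 0)"
    by blast
qed

section \<open>Calculus of test functions\<close>

lemma test_functions_mono: "\<Omega> \<subseteq> \<Omega>' \<Longrightarrow> test_functions \<Omega> \<subseteq> test_functions \<Omega>'"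
  by (auto simp: test_functions_def)

lemma partial_derivs_append: "partial_derivs (is @ js) \<phi> = partial_derivs is (partial_derivs js \<phi>)"
  by (induction "is") auto

lemma has_derivative_partial_deriv:
  fixes f :: "real ^ 'm::finite \<Rightarrow> real"
  assumes "f differentiable (at x)"
  shows "(f has_derivative (\<lambda>h. \<Sum>i\<in>UNIV. h $ i * partial_deriv i f x)) (at x)"
proof -
  have f: "(f has_derivative frechet_derivative f (at x)) (at x)"
    using assms by (simp add: frechet_derivative_works)
  then interpret bounded_linear "frechet_derivative f (at x)"
    by (rule has_derivative_bounded_linear)
  have "frechet_derivative f (at x) h = (\<Sum>i\<in>UNIV. h $ i * partial_deriv i f x)" for h
  proof -
    have "frechet_derivative f (at x) h = frechet_derivative f (at x) (\<Sum>i\<in>UNIV. h $ i *\<^sub>R axis i 1)"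
      using basis_expansion[of h] by (simp add: scalar_mult_eq_scaleR)
    then show ?thesis by (simp add: sum scaleR partial_deriv_def)
  qed
  then have "frechet_derivative f (at x) = (\<lambda>h. \<Sum>i\<in>UNIV. h $ i * partial_deriv i f x)" ..
  with f show ?thesis by simp
qed

lemma partial_deriv_eqI:
  assumes "(f has_derivative f') (at x)"
  shows "partial_deriv i f x = f' (axis i 1)"
  using frechet_derivative_at[OF assms] by (simp add: partial_deriv_def)

lemma test_function_differentiable:
  "\<phi> \<in> test_functions \<Omega> \<Longrightarrow> partial_derivs is \<phi> differentiable (at x)"
  by (simp add: test_functions_def)

lemma test_function_partial_derivs:
  assumes "\<phi> \<in> test_functions \<Omega>"
  shows "partial_derivs is \<phi> \<in> test_functions \<Omega>"
proof -
  have supp: "closure {x. partial_deriv i f x \<noteq> 0} \<subseteq> closure {x. f x \<noteq> 0}" for i and f :: "real^'a \<Rightarrow> real"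
  proof (rule closure_minimal)
    show "{x. partial_deriv i f x \<noteq> 0} \<subseteq> closure {x. f x \<noteq> 0}"
    proof (rule subsetI, rule ccontr)
      fix x assume x: "x \<in> {x. partial_deriv i f x \<noteq> 0}" "x \<notin> closure {x. f x \<noteq> 0}"
      have "((\<lambda>x. 0) has_derivative (\<lambda>h. 0)) (at x)" by simp
      then have "(f has_derivative (\<lambda>h. 0)) (at x)"
        by (rule has_derivative_transform_within_open[of _ _ _ _ "- closure {x. f x \<noteq> 0}"])
           (use x closure_subset[of "{x. f x \<noteq> 0}"] in auto)
      from partial_deriv_eqI[OF this] x show False by auto
    qed
  qed auto
  have "closure {x. partial_derivs is \<phi> x \<noteq> 0} \<subseteq> closure {x. \<phi> x \<noteq> 0}"
    by (induction "is") (use supp in force)+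
  moreover from this have "compact (closure {x. partial_derivs is \<phi> x \<noteq> 0})"
    using assms unfolding test_functions_def mem_Collect_eq
    by (metis bounded_subset closed_closure compact_eq_bounded_closed)
  ultimately show ?thesis
    using assms by (auto simp: test_functions_def partial_derivs_append[symmetric])
qed

lemma test_function_partial_deriv:
  "\<phi> \<in> test_functions \<Omega> \<Longrightarrow> partial_deriv i \<phi> \<in> test_functions \<Omega>"
  using test_function_partial_derivs[of \<phi> \<Omega> "[i]"] by simp

lemma test_function_continuous:
  "\<phi> \<in> test_functions \<Omega> \<Longrightarrow> continuous_on UNIV \<phi>"
  using test_function_differentiable[of \<phi> \<Omega> "[]"]
  by (auto intro!: differentiable_imp_continuous_on simp: differentiable_on_def)

lemma test_function_borel [measurable_dest]:
  "\<phi> \<in> test_functions \<Omega> \<Longrightarrow> \<phi> \<in> borel_measurable borel"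
  by (intro borel_measurable_continuous_onI test_function_continuous)

lemma test_function_zero:
  assumes "\<phi> \<in> test_functions \<Omega>" "x \<notin> \<Omega>"
  shows "\<phi> x = 0"
  using assms closure_subset[of "{x. \<phi> x \<noteq> 0}"] by (auto simp: test_functions_def)

lemma test_function_bounded:
  assumes "\<phi> \<in> test_functions \<Omega>"
  obtains B where "B \<ge> 0" "\<And>x. \<bar>\<phi> x\<bar> \<le> B"
proof -
  let ?K = "closure {x. \<phi> x \<noteq> 0}"
  have "compact (\<phi> ` ?K)"
    using assms test_function_continuous[OF assms]
    by (intro compact_continuous_image) (auto simp: test_functions_def intro: continuous_on_subset)
  then obtain B where B: "B > 0" "\<And>x. x \<in> ?K \<Longrightarrow> \<bar>\<phi> x\<bar> \<le> B"
    using bounded_pos[of "\<phi> ` ?K"] by (auto dest: compact_imp_bounded)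
  have "\<bar>\<phi> x\<bar> \<le> B" for x
    using B closure_subset[of "{x. \<phi> x \<noteq> 0}"] by (cases "\<phi> x = 0") auto
  with B(1) show ?thesis by (intro that[of B]) auto
qed

lemma test_function_integrable:
  fixes \<phi> :: "real ^ 'm::finite \<Rightarrow> real"
  assumes "\<phi> \<in> test_functions \<Omega>"
  shows "integrable lborel \<phi>"
proof -
  let ?K = "closure {x. \<phi> x \<noteq> 0}"
  have "integrable lborel (\<lambda>x. indicator ?K x *\<^sub>R \<phi> x)"
    using assms test_function_continuous[OF assms]
    by (intro borel_integrable_compact) (auto simp: test_functions_def intro: continuous_on_subset)
  moreover have eq: "indicator ?K x *\<^sub>R \<phi> x = \<phi> x" for x
    using closure_subset[of "{x. \<phi> x \<noteq> 0}"] by (auto simp: indicator_def)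
  ultimately show ?thesis by (simp only: eq)
qed

lemma partial_derivs_shift:
  assumes "\<phi> \<in> test_functions \<Omega>"
  shows "partial_derivs is (\<lambda>x. \<phi> (x + a)) = (\<lambda>x. partial_derivs is \<phi> (x + a))"
proof (induction "is")
  case (Cons i is')
  have "partial_deriv i (\<lambda>x. partial_derivs is' \<phi> (x + a)) x = partial_derivs (i # is') \<phi> (x + a)" for x
  proof -
    let ?f = "partial_derivs is' \<phi>"
    have "(?f has_derivative frechet_derivative ?f (at (x + a))) (at (x + a))"
      using test_function_differentiable[OF assms] by (simp add: frechet_derivative_works)
    from has_derivative_compose[OF has_derivative_add[OF has_derivative_ident has_derivative_const] this]
    have "((\<lambda>x. ?f (x + a)) has_derivative (\<lambda>h. frechet_derivative ?f (at (x + a)) (h + 0))) (at x)" .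
    from partial_deriv_eqI[OF this] show ?thesis by (simp add: partial_deriv_def)
  qed
  then show ?case by (auto simp: Cons)
qed auto

lemma test_function_shift:
  assumes "\<phi> \<in> test_functions U" "\<And>x. x \<in> U \<Longrightarrow> x - a \<in> \<Omega>"
  shows "(\<lambda>x. \<phi> (x + a)) \<in> test_functions \<Omega>"
proof -
  have "{x. \<phi> (x + a) \<noteq> 0} = (\<lambda>x. x - a) ` {x. \<phi> x \<noteq> 0}"
    by (auto intro!: image_eqI[of _ _ "_ + a"])
  then have *: "closure {x. \<phi> (x + a) \<noteq> 0} = (\<lambda>x. x - a) ` closure {x. \<phi> x \<noteq> 0}"
    by (simp add: closure_translation_subtract)
  have "partial_derivs is (\<lambda>x. \<phi> (x + a)) differentiable (at x)" for "is" x
    unfolding partial_derivs_shift[OF assms(1)]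
    by (rule differentiable_compose[of "partial_derivs is \<phi>" "\<lambda>x. x + a", unfolded o_def])
       (auto intro: test_function_differentiable[OF assms(1)])
  moreover have "compact (closure {x. \<phi> (x + a) \<noteq> 0})"
    using assms(1) unfolding * by (intro compact_translation_subtract) (simp add: test_functions_def)
  moreover have "closure {x. \<phi> (x + a) \<noteq> 0} \<subseteq> \<Omega>"
    using assms unfolding * by (auto simp: test_functions_def)
  ultimately show ?thesis
    by (simp add: test_functions_def)
qed

lemma partial_derivs_cmult:
  assumes "\<phi> \<in> test_functions \<Omega>"
  shows "partial_derivs is (\<lambda>x. c * \<phi> x) = (\<lambda>x. c * partial_derivs is \<phi> x)"
proof (induction "is")
  case (Cons i is')
  have "partial_deriv i (\<lambda>x. c * partial_derivs is' \<phi> x) x = c * partial_derivs (i # is') \<phi> x" for x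
  proof -
    let ?f = "partial_derivs is' \<phi>"
    have "(?f has_derivative frechet_derivative ?f (at x)) (at x)"
      using test_function_differentiable[OF assms] by (simp add: frechet_derivative_works)
    from partial_deriv_eqI[OF has_derivative_mult_right[OF this, of c]]
    show ?thesis by (simp add: partial_deriv_def)
  qed
  then show ?case by (auto simp: Cons)
qed auto

lemma test_function_cmult:
  fixes c :: real
  assumes "\<phi> \<in> test_functions \<Omega>"
  shows "(\<lambda>x. c * \<phi> x) \<in> test_functions \<Omega>"
proof (cases "c = 0")
  case True
  have "partial_derivs is (\<lambda>x. c * \<phi> x) = (\<lambda>x. 0)" for "is"
    using partial_derivs_cmult[OF assms, of "is" 0] True by simp
  then show ?thesis using True by (simp add: test_functions_def)
next
  case False
  then show ?thesis
    using assms partial_derivs_cmult[OF assms]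
    by (auto simp: test_functions_def intro!: differentiable_mult)
qed

lemma test_function_line_derivative:
  assumes "\<phi> \<in> test_functions \<Omega>"
  shows "((\<lambda>t. \<phi> (y + t *\<^sub>R axis k 1)) has_real_derivative
           partial_deriv k \<phi> (y + t *\<^sub>R axis k 1)) (at t within S)"
proof -
  let ?e = "axis k 1 :: real^'a"
  have "((\<lambda>t. y + t *\<^sub>R ?e) has_derivative (\<lambda>h. h *\<^sub>R ?e)) (at t within S)"
    by (auto intro!: derivative_eq_intros)
  moreover have "(\<phi> has_derivative (\<lambda>h. \<Sum>i\<in>UNIV. h $ i * partial_deriv i \<phi> (y + t *\<^sub>R ?e)))
      (at (y + t *\<^sub>R ?e))"
    using test_function_differentiable[OF assms, of "[]"] by (intro has_derivative_partial_deriv) simp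
  ultimately have "((\<lambda>t. \<phi> (y + t *\<^sub>R ?e)) has_derivative
      (\<lambda>h. \<Sum>i\<in>UNIV. (h *\<^sub>R ?e) $ i * partial_deriv i \<phi> (y + t *\<^sub>R ?e))) (at t within S)"
    by (rule has_derivative_compose)
  moreover have "(\<Sum>i\<in>UNIV. (h *\<^sub>R ?e) $ i * partial_deriv i \<phi> (y + t *\<^sub>R ?e))
      = partial_deriv k \<phi> (y + t *\<^sub>R ?e) * h" for h
  proof -
    have "(\<Sum>i\<in>UNIV. (h *\<^sub>R ?e) $ i * partial_deriv i \<phi> (y + t *\<^sub>R ?e))
        = (\<Sum>i\<in>UNIV. if i = k then h * partial_deriv i \<phi> (y + t *\<^sub>R ?e) else 0)"
      by (rule sum.cong) (auto simp: axis_def)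
    then show ?thesis by simp
  qed
  ultimately show ?thesis by (simp add: has_field_derivative_def)
qed

lemma test_function_line_integral:
  assumes "\<phi> \<in> test_functions \<Omega>" "h \<ge> 0"
  shows "(LINT t|lborel. indicator {0..h} t * partial_deriv k \<phi> (x + t *\<^sub>R axis k 1))
           = \<phi> (x + h *\<^sub>R axis k 1) - \<phi> x"
proof -
  have c: "continuous_on UNIV (\<lambda>t. partial_deriv k \<phi> (x + t *\<^sub>R axis k 1))"
    by (rule continuous_on_compose2[OF test_function_continuous[OF test_function_partial_deriv[OF assms(1)]]])
       (auto intro!: continuous_intros)
  have "(LINT t|lborel. partial_deriv k \<phi> (x + t *\<^sub>R axis k 1) * indicator {0..h} t)
      = \<phi> (x + h *\<^sub>R axis k 1) - \<phi> (x + 0 *\<^sub>R axis k 1)"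
    by (rule integral_FTC_Icc_real)
       (use assms test_function_line_derivative[OF assms(1)] c in
         \<open>auto simp: continuous_on_eq_continuous_at\<close>)
  then show ?thesis by (simp add: mult.commute)
qed

text \<open>
  Two applications of the mean value theorem. The left-hand side is symmetric in \<open>i\<close> and \<open>j\<close>, which
  is what makes mixed partial derivatives agree.
\<close>

lemma test_function_second_difference:
  assumes "\<phi> \<in> test_functions \<Omega>" "s > 0"
  shows "\<exists>\<sigma> \<tau>. 0 < \<sigma> \<and> \<sigma> < s \<and> 0 < \<tau> \<and> \<tau> < s \<and>
     \<phi> (x + s *\<^sub>R axis i 1 + s *\<^sub>R axis j 1) - \<phi> (x + s *\<^sub>R axis i 1) - \<phi> (x + s *\<^sub>R axis j 1) + \<phi> x
     = s * s * partial_derivs [j, i] \<phi> (x + \<sigma> *\<^sub>R axis i 1 + \<tau> *\<^sub>R axis j 1)"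
proof -
  let ?G = "\<lambda>t. \<phi> ((x + s *\<^sub>R axis j 1) + t *\<^sub>R axis i 1) - \<phi> (x + t *\<^sub>R axis i 1)"
  have dG: "(?G has_real_derivative partial_deriv i \<phi> ((x + s *\<^sub>R axis j 1) + t *\<^sub>R axis i 1)
      - partial_deriv i \<phi> (x + t *\<^sub>R axis i 1)) (at t)" for t
    by (intro DERIV_diff test_function_line_derivative[OF assms(1)])
  obtain \<sigma> where \<sigma>: "0 < \<sigma>" "\<sigma> < s" "?G s - ?G 0 = (s - 0) *
     (partial_deriv i \<phi> ((x + s *\<^sub>R axis j 1) + \<sigma> *\<^sub>R axis i 1) - partial_deriv i \<phi> (x + \<sigma> *\<^sub>R axis i 1))"
    using MVT2[OF assms(2) dG] by blast
  let ?H = "\<lambda>t. partial_deriv i \<phi> ((x + \<sigma> *\<^sub>R axis i 1) + t *\<^sub>R axis j 1)"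
  have dH: "(?H has_real_derivative
      partial_deriv j (partial_deriv i \<phi>) ((x + \<sigma> *\<^sub>R axis i 1) + t *\<^sub>R axis j 1)) (at t)" for t
    by (rule test_function_line_derivative[OF test_function_partial_deriv[OF assms(1)]])
  obtain \<tau> where \<tau>: "0 < \<tau>" "\<tau> < s" "?H s - ?H 0 = (s - 0) *
      partial_deriv j (partial_deriv i \<phi>) ((x + \<sigma> *\<^sub>R axis i 1) + \<tau> *\<^sub>R axis j 1)"
    using MVT2[OF assms(2) dH] by blast
  have "?G s - ?G 0 = s * (s * partial_deriv j (partial_deriv i \<phi>) ((x + \<sigma> *\<^sub>R axis i 1) + \<tau> *\<^sub>R axis j 1))"
    using \<sigma>(3) \<tau>(3) by (simp add: add_ac)
  with \<sigma> \<tau> show ?thesis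
    by (intro exI[of _ \<sigma>] exI[of _ \<tau>]) (simp add: add_ac)
qed

lemma test_function_partial_derivs_commute:
  fixes \<phi> :: "real ^ 'm::finite \<Rightarrow> real"
  assumes "\<phi> \<in> test_functions \<Omega>"
  shows "partial_derivs [i, j] \<phi> x = partial_derivs [j, i] \<phi> x"
proof (rule ccontr)
  let ?f = "partial_derivs [i, j] \<phi>" and ?g = "partial_derivs [j, i] \<phi>"
  assume "?f x \<noteq> ?g x"
  define \<epsilon> where "\<epsilon> = \<bar>?f x - ?g x\<bar> / 2"
  have "\<epsilon> > 0" using \<open>?f x \<noteq> ?g x\<close> by (simp add: \<epsilon>_def)
  have "isCont ?f x" "isCont ?g x"
    using test_function_continuous[OF test_function_partial_derivs[OF assms]]
    by (simp_all only: continuous_on_eq_continuous_at[OF open_UNIV] UNIV_I)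
  then obtain d1 d2 where d1: "d1 > 0" "\<And>y. dist y x < d1 \<Longrightarrow> \<bar>?f y - ?f x\<bar> < \<epsilon>"
    and d2: "d2 > 0" "\<And>y. dist y x < d2 \<Longrightarrow> \<bar>?g y - ?g x\<bar> < \<epsilon>"
    using \<open>\<epsilon> > 0\<close> unfolding continuous_at_eps_delta dist_real_def by metis
  define s where "s = min d1 d2 / 2"
  have s: "s > 0" "2 * s \<le> d1" "2 * s \<le> d2" using d1 d2 by (auto simp: s_def)
  obtain \<sigma> \<tau> where 1: "0 < \<sigma>" "\<sigma> < s" "0 < \<tau>" "\<tau> < s"
     "\<phi> (x + s *\<^sub>R axis i 1 + s *\<^sub>R axis j 1) - \<phi> (x + s *\<^sub>R axis i 1) - \<phi> (x + s *\<^sub>R axis j 1) + \<phi> x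
     = s * s * ?g (x + \<sigma> *\<^sub>R axis i 1 + \<tau> *\<^sub>R axis j 1)"
    using test_function_second_difference[OF assms s(1)] by blast
  obtain \<sigma>' \<tau>' where 2: "0 < \<sigma>'" "\<sigma>' < s" "0 < \<tau>'" "\<tau>' < s"
     "\<phi> (x + s *\<^sub>R axis j 1 + s *\<^sub>R axis i 1) - \<phi> (x + s *\<^sub>R axis j 1) - \<phi> (x + s *\<^sub>R axis i 1) + \<phi> x
     = s * s * ?f (x + \<sigma>' *\<^sub>R axis j 1 + \<tau>' *\<^sub>R axis i 1)"
    using test_function_second_difference[OF assms s(1)] by blast
  let ?y = "x + \<sigma> *\<^sub>R axis i 1 + \<tau> *\<^sub>R axis j 1" and ?z = "x + \<sigma>' *\<^sub>R axis j 1 + \<tau>' *\<^sub>R axis i 1"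
  have "s * s * ?g ?y = s * s * ?f ?z"
    unfolding 1(5)[symmetric] 2(5)[symmetric] by (simp add: add_ac)
  then have eq: "?g ?y = ?f ?z" using s(1) by (simp only: mult_cancel_left) auto
  have nrm: "dist (x + a *\<^sub>R axis k 1 + b *\<^sub>R axis l 1) x < 2 * s"
    if "0 < a" "a < s" "0 < b" "b < s" for a b and k l :: 'm
  proof -
    have "dist (x + a *\<^sub>R axis k 1 + b *\<^sub>R axis l 1) x = norm (a *\<^sub>R axis k (1::real) + b *\<^sub>R axis l 1)"
      by (simp add: dist_norm add_ac)
    also have "\<dots> \<le> a + b"
      by (rule norm_triangle_le) (use that in simp)
    finally show ?thesis using that by simp
  qed
  have "\<bar>?g ?y - ?g x\<bar> < \<epsilon>" "\<bar>?f ?z - ?f x\<bar> < \<epsilon>"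
    using d1(2)[of ?z] d2(2)[of ?y] nrm[of \<sigma> \<tau> i j] nrm[of \<sigma>' \<tau>' j i] 1 2 s
    by (meson less_le_trans)+
  then have "\<bar>?f x - ?g x\<bar> < 2 * \<epsilon>" using eq by linarith
  then show False by (simp add: \<epsilon>_def)
qed

section \<open>Weak derivatives\<close>

lemma integrable_mult_bounded:
  fixes f g :: "'a \<Rightarrow> real"
  assumes f: "integrable M f" and g: "g \<in> borel_measurable M" and B: "\<And>x. \<bar>g x\<bar> \<le> B"
  shows "integrable M (\<lambda>x. f x * g x)"
proof (rule Bochner_Integration.integrable_bound)
  show "integrable M (\<lambda>x. B * f x)" using f by simp
  show "(\<lambda>x. f x * g x) \<in> borel_measurable M"
    using borel_measurable_integrable[OF f] g by simp
  have "\<bar>f x * g x\<bar> \<le> \<bar>B * f x\<bar>" for x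
  proof -
    have "\<bar>f x\<bar> * \<bar>g x\<bar> \<le> \<bar>f x\<bar> * \<bar>B\<bar>" using B[of x] by (intro mult_left_mono) auto
    then show ?thesis by (simp add: abs_mult mult.commute)
  qed
  then show "AE x in M. norm (f x * g x) \<le> norm (B * f x)" by simp
qed

text \<open>
  For a merely Lebesgue measurable \<open>g\<close>, measurability of \<open>(x, t) \<mapsto> g (x + t e)\<close> with respect to the
  product of the Borel measures may fail. Before Fubini's theorem is applied, functions are therefore
  replaced by Borel representatives.
\<close>

lemma lebesgue_integral_borel_representative:
  fixes f f0 :: "'a::euclidean_space \<Rightarrow> real"
  assumes f0: "f0 \<in> borel_measurable borel" and ae: "AE x in lborel. f0 x = f x"
  shows "integrable lebesgue f \<longleftrightarrow> integrable lborel f0"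
    and "integral\<^sup>L lebesgue f = integral\<^sup>L lborel f0"
proof -
  have m0: "f0 \<in> borel_measurable lborel" using f0 by simp
  have ae': "AE x in lebesgue. f0 x = f x" using ae by (simp only: AE_lebesgue_iff)
  have m: "f \<in> borel_measurable lebesgue"
    using borel_measurable_AE[OF measurable_completion[OF m0] ae'] .
  show "integrable lebesgue f \<longleftrightarrow> integrable lborel f0"
    using integrable_cong_AE[OF measurable_completion[OF m0] m ae'] integrable_completion[OF m0] by simp
  show "integral\<^sup>L lebesgue f = integral\<^sup>L lborel f0"
    using integral_cong_AE[OF measurable_completion[OF m0] m ae'] integral_completion[OF m0] by simp
qed

lemma L1_loc_linear:
  assumes "f \<in> L1_loc \<Omega>" "g \<in> L1_loc \<Omega>"
  shows "(\<lambda>x. a * f x + b * g x) \<in> L1_loc \<Omega>"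
  using assms by (auto simp: L1_loc_def intro!: set_integral_add(1) set_integrable_mult_right)

lemma L1_loc_borel_representative:
  assumes \<Omega>: "open \<Omega>" and f: "f \<in> L1_loc \<Omega>"
  obtains f0 where "f0 \<in> borel_measurable borel" "AE x in lborel. x \<in> \<Omega> \<longrightarrow> f x = f0 x"
proof -
  let ?f = "\<lambda>x. if x \<in> \<Omega> then f x else 0"
  have "\<exists>D. countable D \<and> D \<subseteq> Pow \<Omega> \<and> (\<forall>X\<in>D. \<exists>a b. X = cbox a b) \<and> \<Union>D = \<Omega>"
  proof (rule open_countable_Union_open_cbox[OF \<Omega>])
    fix D assume D: "countable D" "D \<subseteq> Pow \<Omega>" "\<And>X. X \<in> D \<Longrightarrow> \<exists>a b. X = cbox a b" "\<Union>D = \<Omega>"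
    show ?thesis by (intro exI[of _ D] conjI ballI D)
  qed
  then obtain D where D: "countable D" "D \<subseteq> Pow \<Omega>" "\<And>X. X \<in> D \<Longrightarrow> \<exists>a b. X = cbox a b" "\<Union>D = \<Omega>"
    by (elim exE conjE) (rule that, simp_all)
  have "?f \<in> borel_measurable lebesgue"
  proof (rule measurable_piecewise_restrict[where C = "insert (- \<Omega>) D"])
    show "countable (insert (- \<Omega>) D)" using D(1) by simp
    show "X \<inter> space lebesgue \<in> sets lebesgue" if "X \<in> insert (- \<Omega>) D" for X
    proof (cases "X = - \<Omega>")
      case True
      have "- \<Omega> \<in> sets borel" using \<Omega> by simp
      then show ?thesis using True by (simp add: sets_completionI_sets)
    next
      case False
      then show ?thesis using D(3)[of X] that by auto
    qed
    show "space lebesgue \<subseteq> \<Union> (insert (- \<Omega>) D)" using D(4) by auto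
    show "?f \<in> borel_measurable (lebesgue_on X)" if "X \<in> insert (- \<Omega>) D" for X
    proof (cases "X = - \<Omega>")
      case True
      have "(\<lambda>x. 0::real) \<in> borel_measurable (lebesgue_on X)" by simp
      then show ?thesis
        by (rule measurable_cong[THEN iffD1, rotated]) (auto simp: True)
    next
      case False
      then have X: "X \<in> D" using that by simp
      then obtain a b where ab: "X = cbox a b" using D(3) by blast
      have "X \<subseteq> \<Omega>" using D(2) X by blast
      then have "f absolutely_integrable_on X" using f by (simp add: ab L1_loc_def)
      then have "f \<in> borel_measurable (lebesgue_on X)"
        using ab by (intro absolutely_integrable_measurable[THEN iffD1, THEN conjunct1]) auto
      then show ?thesis
        by (rule measurable_cong[THEN iffD1, rotated]) (use \<open>X \<subseteq> \<Omega>\<close> in auto)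
    qed
  qed
  from completion_ex_borel_measurable_real[OF this] obtain f0
    where "f0 \<in> borel_measurable lborel" "AE x in lborel. ?f x = f0 x" by blast
  then show ?thesis by (intro that[of f0]) (auto elim!: eventually_mono)
qed

lemma L1_loc_integrable_compact:
  fixes f f0 :: "real ^ 'm::finite \<Rightarrow> real"
  assumes f: "f \<in> L1_loc \<Omega>" and f0: "f0 \<in> borel_measurable borel"
    and ae: "AE x in lborel. x \<in> \<Omega> \<longrightarrow> f x = f0 x" and K: "compact K" "K \<subseteq> \<Omega>"
  shows "integrable lborel (\<lambda>x. indicator K x * f0 x)"
proof -
  have int: "integrable lebesgue (\<lambda>x. indicator K x * f x)"
    using f K by (simp add: L1_loc_def set_integrable_def)
  have "K \<in> sets borel" using K by (simp add: borel_compact)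
  then have m: "(\<lambda>x. indicator K x * f0 x) \<in> borel_measurable borel"
    using f0 by simp
  have ae': "AE x in lborel. indicator K x * f0 x = indicator K x * f x"
    using ae by (rule eventually_mono) (use K in \<open>auto split: split_indicator\<close>)
  show ?thesis
    using int lebesgue_integral_borel_representative(1)[OF m ae'] by simp
qed

lemma L1_loc_test_function:
  fixes f f0 :: "real ^ 'm::finite \<Rightarrow> real"
  assumes f: "f \<in> L1_loc \<Omega>" and f0: "f0 \<in> borel_measurable borel"
    and ae: "AE x in lborel. x \<in> \<Omega> \<longrightarrow> f x = f0 x" and \<phi>: "\<phi> \<in> test_functions \<Omega>"
  shows "integrable lborel (\<lambda>x. f0 x * \<phi> x)"
    and "set_integrable lebesgue \<Omega> (\<lambda>x. f x * \<phi> x)"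
    and "(LINT x:\<Omega>|lebesgue. f x * \<phi> x) = (LINT x|lborel. f0 x * \<phi> x)"
proof -
  let ?K = "closure {x. \<phi> x \<noteq> 0}"
  have K: "compact ?K" "?K \<subseteq> \<Omega>" using \<phi> by (auto simp: test_functions_def)
  have zK: "\<phi> x = 0" if "x \<notin> ?K" for x
    using that closure_subset[of "{x. \<phi> x \<noteq> 0}"] by auto
  obtain B where B: "\<And>x. \<bar>\<phi> x\<bar> \<le> B" using test_function_bounded[OF \<phi>] by blast
  have m0: "(\<lambda>x. f0 x * \<phi> x) \<in> borel_measurable borel"
    using f0 test_function_borel[OF \<phi>] by simp
  have "integrable lborel (\<lambda>x. (indicator ?K x * f0 x) * \<phi> x)"
    by (rule integrable_mult_bounded[OF L1_loc_integrable_compact[OF f f0 ae K] _ B])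
       (use test_function_borel[OF \<phi>] in simp)
  moreover have eq: "(indicator ?K x * f0 x) * \<phi> x = f0 x * \<phi> x" for x
    using zK[of x] by (auto split: split_indicator)
  ultimately show i0: "integrable lborel (\<lambda>x. f0 x * \<phi> x)" by (simp only: eq)
  have ae': "AE x in lborel. f0 x * \<phi> x = indicator \<Omega> x *\<^sub>R (f x * \<phi> x)"
    using ae
    by (rule eventually_mono) (use test_function_zero[OF \<phi>] in \<open>auto split: split_indicator\<close>)
  show "set_integrable lebesgue \<Omega> (\<lambda>x. f x * \<phi> x)"
    unfolding set_integrable_def
    using lebesgue_integral_borel_representative(1)[OF m0 ae'] i0 by blast
  show "(LINT x:\<Omega>|lebesgue. f x * \<phi> x) = (LINT x|lborel. f0 x * \<phi> x)"
    unfolding set_lebesgue_integral_def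
    using lebesgue_integral_borel_representative(2)[OF m0 ae'] .
qed

lemma L1_loc_test_function_integrable:
  assumes "open \<Omega>" "f \<in> L1_loc \<Omega>" "\<phi> \<in> test_functions \<Omega>"
  shows "set_integrable lebesgue \<Omega> (\<lambda>x. f x * \<phi> x)"
  using L1_loc_borel_representative[OF assms(1,2)] L1_loc_test_function(2)[OF assms(2) _ _ assms(3)]
  by blast

text \<open>
  The chosen representative \<open>weak_deriv\<close> is arbitrary on a null set; uniqueness almost everywhere is
  what allows computing with it.
\<close>

lemma has_weak_deriv_unique:
  assumes \<Omega>: "open \<Omega>" and "has_weak_deriv \<Omega> is u g" "has_weak_deriv \<Omega> is u h"
  shows "AE x in lborel. x \<in> \<Omega> \<longrightarrow> g x = h x"
proof -
  have L: "g \<in> L1_loc \<Omega>" "h \<in> L1_loc \<Omega>" using assms by (auto simp: has_weak_deriv_def)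
  have "(\<lambda>x. g x - h x) \<in> L1_loc \<Omega>"
    using L1_loc_linear[OF L, of 1 "-1"] by simp
  moreover have "(LINT x:\<Omega>|lebesgue. (g x - h x) * \<phi> x) = 0" if \<phi>: "\<phi> \<in> test_functions \<Omega>" for \<phi>
  proof -
    have "(-1) ^ length is * (LINT x:\<Omega>|lebesgue. g x * \<phi> x)
        = (-1) ^ length is * (LINT x:\<Omega>|lebesgue. h x * \<phi> x)"
      using assms \<phi> by (simp add: has_weak_deriv_def)
    then have "(LINT x:\<Omega>|lebesgue. g x * \<phi> x) = (LINT x:\<Omega>|lebesgue. h x * \<phi> x)" by simp
    then show ?thesis
      using L1_loc_test_function_integrable[OF \<Omega> L(1) \<phi>] L1_loc_test_function_integrable[OF \<Omega> L(2) \<phi>]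
      by (simp add: left_diff_distrib)
  qed
  ultimately show ?thesis
    using fundamental_lemma[OF \<Omega>, of "\<lambda>x. g x - h x"] by simp
qed

lemma has_weak_deriv_weak_deriv:
  "has_weak_deriv \<Omega> is u g \<Longrightarrow> has_weak_deriv \<Omega> is u (weak_deriv \<Omega> is u)"
  unfolding weak_deriv_def by (metis someI)

lemma has_weak_deriv_linear:
  assumes \<Omega>: "open \<Omega>" and u: "has_weak_deriv \<Omega> is u g" and v: "has_weak_deriv \<Omega> is v h"
  shows "has_weak_deriv \<Omega> is (\<lambda>x. a * u x + b * v x) (\<lambda>x. a * g x + b * h x)"
proof -
  have L: "u \<in> L1_loc \<Omega>" "g \<in> L1_loc \<Omega>" "v \<in> L1_loc \<Omega>" "h \<in> L1_loc \<Omega>"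
    using u v by (auto simp: has_weak_deriv_def)
  have lin: "(LINT x:\<Omega>|lebesgue. (a * p x + b * q x) * \<phi> x)
      = a * (LINT x:\<Omega>|lebesgue. p x * \<phi> x) + b * (LINT x:\<Omega>|lebesgue. q x * \<phi> x)"
    if "p \<in> L1_loc \<Omega>" "q \<in> L1_loc \<Omega>" "\<phi> \<in> test_functions \<Omega>" for p q \<phi>
  proof -
    have "(LINT x:\<Omega>|lebesgue. (a * p x + b * q x) * \<phi> x)
        = (LINT x:\<Omega>|lebesgue. a * (p x * \<phi> x) + b * (q x * \<phi> x))"
      by (simp add: algebra_simps)
    also have "\<dots> = (LINT x:\<Omega>|lebesgue. a * (p x * \<phi> x)) + (LINT x:\<Omega>|lebesgue. b * (q x * \<phi> x))"
      using L1_loc_test_function_integrable[OF \<Omega>] that by (intro set_integral_add(2)) auto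
    finally show ?thesis by simp
  qed
  show ?thesis
    unfolding has_weak_deriv_def
  proof (intro conjI ballI)
    fix \<phi> assume \<phi>: "\<phi> \<in> test_functions \<Omega>"
    show "(LINT x:\<Omega>|lebesgue. (a * u x + b * v x) * partial_derivs is \<phi> x)
        = (-1) ^ length is * (LINT x:\<Omega>|lebesgue. (a * g x + b * h x) * \<phi> x)"
      unfolding lin[OF L(1,3) test_function_partial_derivs[OF \<phi>]] lin[OF L(2,4) \<phi>]
      using u v \<phi> by (simp add: has_weak_deriv_def distrib_left)
  qed (intro L1_loc_linear L)+
qed

lemma has_weak_deriv_diff:
  assumes "open \<Omega>" "has_weak_deriv \<Omega> is u g" "has_weak_deriv \<Omega> is v h"
  shows "has_weak_deriv \<Omega> is (\<lambda>x. u x - v x) (\<lambda>x. g x - h x)"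
  using has_weak_deriv_linear[OF assms, of 1 "-1"] by simp

lemma has_weak_deriv_add:
  assumes "open \<Omega>" "has_weak_deriv \<Omega> is u g" "has_weak_deriv \<Omega> is v h"
  shows "has_weak_deriv \<Omega> is (\<lambda>x. u x + v x) (\<lambda>x. g x + h x)"
  using has_weak_deriv_linear[OF assms, of 1 1] by simp

lemma has_weak_deriv_Nil: "u \<in> L1_loc \<Omega> \<Longrightarrow> has_weak_deriv \<Omega> [] u u"
  by (simp add: has_weak_deriv_def)

text \<open>
  Testing \<open>g\<close> with \<open>\<partial>\<^sub>k\<phi>\<close> amounts to testing \<open>u\<close> with \<open>\<partial>\<^sub>j\<partial>\<^sub>k\<phi>\<close>. A further derivative of \<open>u\<close> therefore
  appears at the end of the list of directions.
\<close>

lemma has_weak_deriv_step: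
  assumes "has_weak_deriv \<Omega> [j] u g" "has_weak_deriv \<Omega> [j, k] u h"
  shows "has_weak_deriv \<Omega> [k] g h"
  unfolding has_weak_deriv_def
proof (intro conjI ballI)
  fix \<phi> assume \<phi>: "\<phi> \<in> test_functions \<Omega>"
  have "(LINT x:\<Omega>|lebesgue. u x * partial_derivs [j] (partial_deriv k \<phi>) x)
      = - (LINT x:\<Omega>|lebesgue. g x * partial_deriv k \<phi> x)"
    using assms(1) test_function_partial_deriv[OF \<phi>] unfolding has_weak_deriv_def by fastforce
  moreover have "(LINT x:\<Omega>|lebesgue. u x * partial_derivs [j, k] \<phi> x)
      = (LINT x:\<Omega>|lebesgue. h x * \<phi> x)"
    using assms(2) \<phi> unfolding has_weak_deriv_def by fastforce
  ultimately show "(LINT x:\<Omega>|lebesgue. g x * partial_derivs [k] \<phi> x)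
      = (-1) ^ length [k] * (LINT x:\<Omega>|lebesgue. h x * \<phi> x)"
    by simp
qed (use assms in \<open>auto simp: has_weak_deriv_def\<close>)

text \<open>
  Weak second derivatives are symmetric because those of the test functions are.
\<close>

lemma has_weak_deriv_commute:
  assumes "has_weak_deriv \<Omega> [i, j] u g"
  shows "has_weak_deriv \<Omega> [j, i] u g"
  using assms test_function_partial_derivs_commute[of _ \<Omega> i j]
  unfolding has_weak_deriv_def by simp

section \<open>Difference quotients converge to weak derivatives\<close>

lemma lborel_integral_shift:
  fixes f :: "'a::euclidean_space \<Rightarrow> real"
  assumes "f \<in> borel_measurable borel"
  shows "integrable lborel (\<lambda>x. f (x + c)) \<longleftrightarrow> integrable lborel f"
    and "(LINT x|lborel. f (x + c)) = (LINT x|lborel. f x)"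
proof -
  have m: "(+) c \<in> measurable lborel borel" by simp
  show "integrable lborel (\<lambda>x. f (x + c)) \<longleftrightarrow> integrable lborel f"
    using integrable_distr_eq[OF m assms] by (simp add: lborel_distr_plus add.commute)
  show "(LINT x|lborel. f (x + c)) = (LINT x|lborel. f x)"
    using integral_distr[OF m assms] by (simp add: lborel_distr_plus add.commute)
qed

lemma AE_lborel_shift:
  fixes c :: "'a::euclidean_space"
  assumes "AE x in lborel. P x"
  shows "AE x in lborel. P (x + c)"
proof -
  have "AE x in distr lborel borel ((+) c). P x" using assms unfolding lborel_distr_plus .
  from AE_distrD[OF _ this] show ?thesis by (simp add: add.commute)
qed

lemma integrable_line_shift:
  fixes g :: "'a::euclidean_space \<Rightarrow> real" and k :: "'a \<times> real \<Rightarrow> real"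
  assumes g: "integrable lborel g" and k: "k \<in> borel_measurable borel" and B: "\<And>z. \<bar>k z\<bar> \<le> B"
  shows "integrable (lborel \<Otimes>\<^sub>M lborel) (\<lambda>(x, t). indicator {a..b} t * g (x + t *\<^sub>R e) * k (x, t))"
proof -
  have gm [measurable]: "g \<in> borel_measurable borel" using borel_measurable_integrable[OF g] by simp
  have shift: "integrable lborel (\<lambda>x. g (x + t *\<^sub>R e))" for t
    using g by (simp add: lborel_integral_shift(1))
  have ind: "integrable lborel (indicator {a..b} :: real \<Rightarrow> real)"
    by (rule integrable_real_indicator) (auto simp: emeasure_lborel_Icc_eq)
  have "integrable (lborel \<Otimes>\<^sub>M lborel) (\<lambda>(t, x). indicator {a..b} t * g (x + t *\<^sub>R e))"
  proof (rule lborel_pair.Fubini_integrable)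
    show "(\<lambda>(t, x). indicator {a..b} t * g (x + t *\<^sub>R e)) \<in> borel_measurable (lborel \<Otimes>\<^sub>M lborel)"
      by measurable
    have "(LINT x|lborel. norm (case (t, x) of (t, x) \<Rightarrow> indicator {a..b} t * g (x + t *\<^sub>R e)))
        = indicator {a..b} t * (LINT x|lborel. \<bar>g x\<bar>)" for t
      using lborel_integral_shift(2)[of "\<lambda>x. \<bar>g x\<bar>" "t *\<^sub>R e"]
      by (simp add: abs_mult)
    then show "integrable lborel (\<lambda>t. LINT x|lborel. norm (case (t, x) of (t, x) \<Rightarrow> indicator {a..b} t * g (x + t *\<^sub>R e)))"
      using ind by simp
    show "AE t in lborel. integrable lborel (\<lambda>x. case (t, x) of (t, x) \<Rightarrow> indicator {a..b} t * g (x + t *\<^sub>R e))"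
      using shift by simp
  qed
  then have "integrable (lborel \<Otimes>\<^sub>M lborel) (\<lambda>(x, t). indicator {a..b} t * g (x + t *\<^sub>R e))"
    by (subst (asm) lborel_pair.integrable_product_swap_iff[symmetric]) simp
  from integrable_mult_bounded[OF this _ B]
  have "integrable (lborel \<Otimes>\<^sub>M lborel) (\<lambda>z. (case z of (x, t) \<Rightarrow> indicator {a..b} t * g (x + t *\<^sub>R e)) * k z)"
    using k by (simp add: lborel_prod)
  moreover have "(\<lambda>z. (case z of (x, t) \<Rightarrow> indicator {a..b} t * g (x + t *\<^sub>R e)) * k z)
      = (\<lambda>(x, t). indicator {a..b} t * g (x + t *\<^sub>R e) * k (x, t))"
    by (auto simp: fun_eq_iff)
  ultimately show ?thesis by simp
qed

lemma test_function_line_integral_back: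
  assumes "\<phi> \<in> test_functions \<Omega>" "h \<ge> 0"
  shows "(LINT t|lborel. indicator {0..h} t * partial_deriv k \<phi> (x - t *\<^sub>R axis k 1))
           = \<phi> x - \<phi> (x - h *\<^sub>R axis k 1)"
proof -
  have "\<phi> x - \<phi> (x - h *\<^sub>R axis k 1) = (LINT t|lborel. indicator {0..h} t *
      partial_deriv k \<phi> (x - h *\<^sub>R axis k 1 + t *\<^sub>R axis k 1))"
    using test_function_line_integral[OF assms, of k "x - h *\<^sub>R axis k 1"] by simp
  also have "\<dots> = (LINT t|lborel. indicator {0..h} (h + (-1) * t) *
      partial_deriv k \<phi> (x - h *\<^sub>R axis k 1 + (h + (-1) * t) *\<^sub>R axis k 1))"
    by (subst lborel_integral_real_affine[where c = "-1" and t = h]) auto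
  also have "\<dots> = (LINT t|lborel. indicator {0..h} t * partial_deriv k \<phi> (x - t *\<^sub>R axis k 1))"
    by (intro Bochner_Integration.integral_cong)
       (auto simp: scaleR_left_diff_distrib split: split_indicator)
  finally show ?thesis by simp
qed

lemma integrable_lborel_imp_L1_loc:
  assumes "integrable lborel f"
  shows "f \<in> L1_loc \<Omega>"
  unfolding L1_loc_def mem_Collect_eq
proof (intro allI impI)
  fix K :: "(real^'a) set" assume "compact K \<and> K \<subseteq> \<Omega>"
  then have "K \<in> sets borel" by (simp add: borel_compact)
  then have "integrable lborel (\<lambda>x. indicator K x *\<^sub>R f x)"
    using assms by (intro integrable_mult_indicator) auto
  then show "set_integrable lebesgue K f"
    unfolding set_integrable_def
    by (subst integrable_completion) auto
qed

text \<open>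
  Both sides have the same integral against every test function \<open>\<phi>\<close> supported in the small ball:
  moving the shift onto \<open>\<phi>\<close> turns the increment of \<open>f\<close> into an integral of \<open>f\<close> against translates of
  \<open>\<partial>\<^sub>k\<phi>\<close>, to which the weak derivative applies. The larger ball leaves room for these translates.
\<close>

lemma weak_deriv_line_integral:
  fixes f g :: "real ^ 'm::finite \<Rightarrow> real"
  assumes f: "integrable lborel f" and g: "integrable lborel g"
    and weak: "\<And>\<psi>. \<psi> \<in> test_functions (ball c (2 * r)) \<Longrightarrow>
        (LINT x|lborel. f x * partial_deriv k \<psi> x) = - (LINT x|lborel. g x * \<psi> x)"
    and h: "0 \<le> h" "h \<le> r"
  shows "AE x in lborel. x \<in> ball c r \<longrightarrow>
    f (x + h *\<^sub>R axis k 1) - f x = (LINT t|lborel. indicator {0..h} t * g (x + t *\<^sub>R axis k 1))"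
proof -
  define e where "e = (axis k 1 :: real ^ 'm)"
  have [measurable]: "f \<in> borel_measurable borel" "g \<in> borel_measurable borel"
    using borel_measurable_integrable[OF f] borel_measurable_integrable[OF g] by simp_all
  define G where "G = (\<lambda>x. LINT t|lborel. indicator {0..h} t * g (x + t *\<^sub>R e))"
  define D where "D = (\<lambda>x. f (x + h *\<^sub>R e) - f x - G x)"
  have G: "integrable lborel G"
    unfolding G_def
    using lborel_pair.integrable_fst[OF integrable_line_shift[OF g, of "\<lambda>_. 1" 1 0 h e]] by simp
  have fh: "integrable lborel (\<lambda>x. f (x + h *\<^sub>R e))"
    using f by (simp add: lborel_integral_shift(1))
  have D: "integrable lborel D"
    unfolding D_def by (intro Bochner_Integration.integrable_diff fh f G)
  have "(LINT x:ball c r|lebesgue. D x * \<phi> x) = 0" if \<phi>: "\<phi> \<in> test_functions (ball c r)" for \<phi>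
  proof -
    have [measurable]: "\<phi> \<in> borel_measurable borel" by (rule test_function_borel[OF \<phi>])
    obtain B where B: "\<And>x. \<bar>\<phi> x\<bar> \<le> B" using test_function_bounded[OF \<phi>] by blast
    note \<phi>' = test_function_partial_deriv[OF \<phi>, of k]
    have [measurable]: "partial_deriv k \<phi> \<in> borel_measurable borel" by (rule test_function_borel[OF \<phi>'])
    obtain B' where B': "\<And>x. \<bar>partial_deriv k \<phi> x\<bar> \<le> B'" using test_function_bounded[OF \<phi>'] by blast
    have mk: "(\<lambda>(x, t). partial_deriv k \<phi> (x - t *\<^sub>R e)) \<in> borel_measurable borel"
    proof -
      have "(\<lambda>(x, t). partial_deriv k \<phi> (x - t *\<^sub>R e)) \<in> borel_measurable (borel \<Otimes>\<^sub>M borel)"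
        by measurable
      then show ?thesis by (simp only: borel_prod)
    qed
    have m\<phi>: "(\<lambda>(x, t). \<phi> x) \<in> borel_measurable (borel :: ((real^'m) \<times> real) measure)"
    proof -
      have "(\<lambda>(x, t). \<phi> x) \<in> borel_measurable (borel \<Otimes>\<^sub>M (borel :: real measure))"
        by measurable
      then show ?thesis by (simp only: borel_prod)
    qed
    have int: "integrable lborel (\<lambda>x. p x * \<psi> x)"
      if "integrable lborel p" "\<psi> \<in> borel_measurable borel" "\<And>x. \<bar>\<psi> x\<bar> \<le> C" for p \<psi> :: "real^'m \<Rightarrow> real" and C
      using that by (intro integrable_mult_bounded[of _ _ _ C]) auto
    have i1: "integrable lborel (\<lambda>x. f x * \<phi> (x - h *\<^sub>R e))" by (rule int[OF f _ B]) measurable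
    have i2: "integrable lborel (\<lambda>x. f x * \<phi> x)" by (rule int[OF f _ B]) measurable
    have i3: "integrable lborel (\<lambda>x. f (x + h *\<^sub>R e) * \<phi> x)" by (rule int[OF fh _ B]) measurable
    have i4: "integrable lborel (\<lambda>x. G x * \<phi> x)" by (rule int[OF G _ B]) measurable
    \<comment> \<open>The summand \<open>t *\<^sub>R 0\<close> below brings the integrand into the shape of \<open>integrable_line_shift\<close>.\<close>
    have "(LINT x|lborel. f (x + h *\<^sub>R e) * \<phi> x) = (LINT x|lborel. f x * \<phi> (x - h *\<^sub>R e))"
      using lborel_integral_shift(2)[of "\<lambda>x. f x * \<phi> (x - h *\<^sub>R e)" "h *\<^sub>R e"] by simp
    then have "(LINT x|lborel. f (x + h *\<^sub>R e) * \<phi> x) - (LINT x|lborel. f x * \<phi> x)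
        = (LINT x|lborel. f x * \<phi> (x - h *\<^sub>R e) - f x * \<phi> x)"
      using i1 i2 by simp
    also have "\<dots> = - (LINT x|lborel. LINT t|lborel. indicator {0..h} t * f (x + t *\<^sub>R 0) * partial_deriv k \<phi> (x - t *\<^sub>R e))"
    proof -
      have "f x * \<phi> (x - h *\<^sub>R e) - f x * \<phi> x
          = - (LINT t|lborel. indicator {0..h} t * f (x + t *\<^sub>R 0) * partial_deriv k \<phi> (x - t *\<^sub>R e))" for x
      proof -
        have "(LINT t|lborel. indicator {0..h} t * f (x + t *\<^sub>R 0) * partial_deriv k \<phi> (x - t *\<^sub>R e))
            = (LINT t|lborel. f x * (indicator {0..h} t * partial_deriv k \<phi> (x - t *\<^sub>R e)))"
          by (simp add: mult_ac)
        also have "\<dots> = f x * (\<phi> x - \<phi> (x - h *\<^sub>R e))"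
          using test_function_line_integral_back[OF \<phi> h(1), of k x] by (simp add: e_def)
        finally show ?thesis by (simp add: algebra_simps)
      qed
      then show ?thesis by simp
    qed
    also have "(LINT x|lborel. LINT t|lborel. indicator {0..h} t * f (x + t *\<^sub>R 0) * partial_deriv k \<phi> (x - t *\<^sub>R e))
        = (LINT t|lborel. LINT x|lborel. indicator {0..h} t * f (x + t *\<^sub>R 0) * partial_deriv k \<phi> (x - t *\<^sub>R e))"
      using lborel_pair.Fubini_integral[OF integrable_line_shift[OF f, of "\<lambda>(x, t). partial_deriv k \<phi> (x - t *\<^sub>R e)" B' 0 h 0, OF mk]] B'
      by (simp add: split_beta')
    also have "\<dots> = (LINT t|lborel. - (LINT x|lborel. indicator {0..h} t * g (x + t *\<^sub>R e) * \<phi> x))"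
    proof (intro Bochner_Integration.integral_cong refl)
      fix t :: real
      show "(LINT x|lborel. indicator {0..h} t * f (x + t *\<^sub>R 0) * partial_deriv k \<phi> (x - t *\<^sub>R e))
          = - (LINT x|lborel. indicator {0..h} t * g (x + t *\<^sub>R e) * \<phi> x)"
      proof (cases "t \<in> {0..h}")
        case True
        have sh: "(\<lambda>x. \<phi> (x + - (t *\<^sub>R e))) \<in> test_functions (ball c (2 * r))"
        proof (rule test_function_shift[OF \<phi>])
          fix x assume x: "x \<in> ball c r"
          have "dist c (x + t *\<^sub>R e) \<le> dist c x + norm (t *\<^sub>R e)"
            using dist_triangle[of c "x + t *\<^sub>R e" x] by (simp add: dist_norm)
          also have "norm (t *\<^sub>R e) \<le> r" using True h by (simp add: e_def)
          finally show "x - - (t *\<^sub>R e) \<in> ball c (2 * r)" using x by simp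
        qed
        have "(LINT x|lborel. f x * partial_deriv k \<phi> (x - t *\<^sub>R e))
            = - (LINT x|lborel. g x * \<phi> (x - t *\<^sub>R e))"
          using weak[OF sh] partial_derivs_shift[OF \<phi>, of "[k]" "- (t *\<^sub>R e)"] by simp
        also have "(LINT x|lborel. g x * \<phi> (x - t *\<^sub>R e)) = (LINT x|lborel. g (x + t *\<^sub>R e) * \<phi> x)"
          using lborel_integral_shift(2)[of "\<lambda>x. g x * \<phi> (x - t *\<^sub>R e)" "t *\<^sub>R e"] by simp
        finally show ?thesis using True by simp
      qed simp
    qed
    also have "\<dots> = - (LINT t|lborel. LINT x|lborel. indicator {0..h} t * g (x + t *\<^sub>R e) * \<phi> x)"
      by simp
    also have "(LINT t|lborel. LINT x|lborel. indicator {0..h} t * g (x + t *\<^sub>R e) * \<phi> x)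
        = (LINT x|lborel. LINT t|lborel. indicator {0..h} t * g (x + t *\<^sub>R e) * \<phi> x)"
      using lborel_pair.Fubini_integral[OF integrable_line_shift[OF g, of "\<lambda>(x, t). \<phi> x" B 0 h e, OF m\<phi>]] B
      by (simp add: split_beta')
    also have "\<dots> = (LINT x|lborel. G x * \<phi> x)"
      by (simp add: G_def)
    finally have "(LINT x|lborel. D x * \<phi> x) = 0"
      using i2 i3 i4 by (simp add: D_def left_diff_distrib)
    then show ?thesis
      using L1_loc_test_function(3)[OF integrable_lborel_imp_L1_loc[OF D] _ _ \<phi>, of D]
        borel_measurable_integrable[OF D] by simp
  qed
  from fundamental_lemma[OF open_ball integrable_lborel_imp_L1_loc[OF D] this]
  show ?thesis by (rule eventually_mono) (auto simp: D_def G_def e_def)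
qed

text \<open>
  On almost every line in direction \<open>e\<close> the restriction of \<open>g\<close> is locally integrable, so by
  one-dimensional Lebesgue differentiation the bad set meets each of these lines in a null set. By
  Fubini, some translate of the bad set is null, hence so is the set itself.
\<close>

lemma lebesgue_differentiation_lines:
  fixes g :: "'a::euclidean_space \<Rightarrow> real"
  assumes g: "integrable lborel g" and h: "\<And>n. h n > 0" "h \<longlonglongrightarrow> 0"
  shows "AE x in lborel. (\<lambda>n. (LINT t|lborel. indicator {0..h n} t * g (x + t *\<^sub>R e)) / h n) \<longlonglongrightarrow> g x"
proof -
  have [measurable]: "g \<in> borel_measurable borel" using borel_measurable_integrable[OF g] by simp
  define G where "G = (\<lambda>n x. (LINT t|lborel. indicator {0..h n} t * g (x + t *\<^sub>R e)) / h n)"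
  have [measurable]: "G n \<in> borel_measurable borel" for n
    unfolding G_def by measurable
  \<comment> \<open>Convergence is rewritten with countable quantifiers only, so that the bad set is visibly Borel.\<close>
  define P where "P = (\<lambda>x. \<forall>i::nat. \<exists>N. \<forall>n\<ge>N. \<bar>G n x - g x\<bar> < inverse (real (Suc i)))"
  have P: "P x \<longleftrightarrow> (\<lambda>n. G n x) \<longlonglongrightarrow> g x" for x
  proof
    assume "(\<lambda>n. G n x) \<longlonglongrightarrow> g x"
    then show "P x" unfolding P_def LIMSEQ_def dist_real_def by auto
  next
    assume *: "P x"
    show "(\<lambda>n. G n x) \<longlonglongrightarrow> g x"
      unfolding LIMSEQ_def dist_real_def
    proof (intro allI impI)
      fix \<epsilon> :: real assume "\<epsilon> > 0"
      then obtain i where "inverse (real (Suc i)) < \<epsilon>" using reals_Archimedean by blast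
      with * show "\<exists>N. \<forall>n\<ge>N. \<bar>G n x - g x\<bar> < \<epsilon>" unfolding P_def by (meson less_trans)
    qed
  qed
  have [measurable]: "Measurable.pred borel P" unfolding P_def by measurable
  have "AE x in lborel. \<forall>N::nat. integrable lborel (\<lambda>t. indicator {- real N..real N} t * g (x + t *\<^sub>R e))"
    unfolding AE_all_countable
  proof
    fix N :: nat
    show "AE x in lborel. integrable lborel (\<lambda>t. indicator {- real N..real N} t * g (x + t *\<^sub>R e))"
      using lborel_pair.AE_integrable_fst[OF integrable_line_shift[OF g, of "\<lambda>_. 1" 1 "- real N" "real N" e]]
      by simp
  qed
  then have "AE x in lborel. AE s in lborel. P (x + s *\<^sub>R e)"
  proof (rule eventually_mono)
    fix x assume int: "\<forall>N::nat. integrable lborel (\<lambda>t. indicator {- real N..real N} t * g (x + t *\<^sub>R e))"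
    define \<gamma> where "\<gamma> = (\<lambda>s. g (x + s *\<^sub>R e))"
    have [measurable]: "\<gamma> \<in> borel_measurable borel" unfolding \<gamma>_def by measurable
    have si: "set_integrable lborel {a..b} \<gamma>" for a b
    proof -
      obtain N :: nat where "max \<bar>a\<bar> \<bar>b\<bar> \<le> real N" using real_arch_simple by blast
      then have "{a..b} \<subseteq> {- real N..real N}" by auto
      moreover have "set_integrable lborel {- real N..real N} \<gamma>"
        using int by (simp add: set_integrable_def \<gamma>_def)
      ultimately show ?thesis by (rule set_integrable_subset[rotated 2]) simp
    qed
    have "\<gamma> integrable_on cbox a b" for a b
      using set_borel_integral_eq_integral(1)[OF si] by simp
    then obtain N where N: "negligible N" "\<And>s \<epsilon>. \<lbrakk>s \<notin> N; 0 < \<epsilon>\<rbrakk> \<Longrightarrow>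
        \<exists>d>0. \<forall>h. 0 < h \<and> h < d \<longrightarrow>
          norm (integral (cbox s (s + h *\<^sub>R One)) \<gamma> /\<^sub>R h ^ DIM(real) - \<gamma> s) < \<epsilon>"
      using integrable_ccontinuous_explicit[of \<gamma>] by blast
    have "P (x + s *\<^sub>R e)" if s: "s \<notin> N" for s
      unfolding P LIMSEQ_def
    proof (intro allI impI)
      fix \<epsilon> :: real assume "\<epsilon> > 0"
      with N(2)[OF s] obtain d where d: "d > 0" "\<forall>h. 0 < h \<and> h < d \<longrightarrow>
          \<bar>integral {s..s + h} \<gamma> / h - \<gamma> s\<bar> < \<epsilon>" by (auto simp: divide_inverse mult.commute)
      have "eventually (\<lambda>n. h n < d) sequentially" using order_tendstoD(2)[OF h(2) d(1)] .
      then obtain M where M: "\<And>n. n \<ge> M \<Longrightarrow> h n < d" by (auto simp: eventually_sequentially)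
      have "G n (x + s *\<^sub>R e) = integral {s..s + h n} \<gamma> / h n" for n
      proof -
        have "integral {s..s + h n} \<gamma> = (LINT t|lborel. indicator {s..s + h n} t * \<gamma> t)"
          using set_borel_integral_eq_integral(2)[OF si[of s "s + h n"]]
          by (simp add: set_lebesgue_integral_def)
        also have "\<dots> = (LINT t|lborel. indicator {s..s + h n} (t + s) * \<gamma> (t + s))"
          using lborel_integral_shift(2)[of "\<lambda>t. indicator {s..s + h n} t * \<gamma> t" s] by simp
        also have "\<dots> = (LINT t|lborel. indicator {0..h n} t * g (x + s *\<^sub>R e + t *\<^sub>R e))"
          by (intro Bochner_Integration.integral_cong)
             (auto simp: \<gamma>_def algebra_simps split: split_indicator)
        finally show ?thesis by (simp add: G_def)
      qed
      then show "\<exists>M. \<forall>n\<ge>M. dist (G n (x + s *\<^sub>R e)) (g (x + s *\<^sub>R e)) < \<epsilon>"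
        using M d(2) h(1) by (intro exI[of _ M]) (auto simp: dist_real_def \<gamma>_def)
    qed
    then have "AE s in lebesgue. P (x + s *\<^sub>R e)"
      using N(1) by (intro AE_I'[of N]) (auto simp: negligible_iff_null_sets)
    then show "AE s in lborel. P (x + s *\<^sub>R e)" by (simp only: AE_lebesgue_iff)
  qed
  then have "AE s in lborel. AE x in lborel. P (x + s *\<^sub>R e)"
    by (subst lborel_pair.AE_commute[symmetric]) measurable
  moreover have "ae_filter (lborel :: real measure) \<noteq> bot"
    by (simp add: ae_filter_eq_bot_iff)
  ultimately have "\<exists>s::real. AE x in lborel. P (x + s *\<^sub>R e)"
    using eventually_happens' by blast
  then obtain s :: real where "AE x in lborel. P (x + s *\<^sub>R e)" ..
  from AE_lborel_shift[OF this, of "- (s *\<^sub>R e)"]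
  show ?thesis unfolding P by (simp add: G_def)
qed

text \<open>
  The one-sided sequence of steps \<open>1 / (n + 1)\<close> is enough for differentiating identities, and being
  countable it lets all exceptional null sets be collected into one.
\<close>

theorem weak_deriv_difference_quotient:
  fixes f g :: "real ^ 'm::finite \<Rightarrow> real"
  assumes \<Omega>: "open \<Omega>" and fg: "has_weak_deriv \<Omega> [k] f g"
  shows "AE x in lborel. x \<in> \<Omega> \<longrightarrow>
    (\<lambda>n. (f (x + (1 / real (Suc n)) *\<^sub>R axis k 1) - f x) * real (Suc n)) \<longlonglongrightarrow> g x"
proof (rule AE_open_local)
  define e where "e = (axis k 1 :: real ^ 'm)"
  define h where "h = (\<lambda>n. 1 / real (Suc n))"
  have h: "h n > 0" "h \<longlonglongrightarrow> 0" for n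
    using LIMSEQ_inverse_real_of_nat by (auto simp: h_def inverse_eq_divide)
  have L: "f \<in> L1_loc \<Omega>" "g \<in> L1_loc \<Omega>" using fg by (auto simp: has_weak_deriv_def)
  obtain f0 where f0: "f0 \<in> borel_measurable borel" "AE x in lborel. x \<in> \<Omega> \<longrightarrow> f x = f0 x"
    using L1_loc_borel_representative[OF \<Omega> L(1)] .
  obtain g0 where g0: "g0 \<in> borel_measurable borel" "AE x in lborel. x \<in> \<Omega> \<longrightarrow> g x = g0 x"
    using L1_loc_borel_representative[OF \<Omega> L(2)] .
  fix x0 assume "x0 \<in> \<Omega>"
  then obtain r' where r': "r' > 0" "cball x0 r' \<subseteq> \<Omega>" using \<Omega> open_contains_cball by blast
  define r where "r = r' / 2"
  define K where "K = cball x0 (2 * r)"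
  have r: "r > 0" and K: "compact K" "K \<subseteq> \<Omega>" using r' by (auto simp: r_def K_def)
  define f1 where "f1 = (\<lambda>x. indicator K x * f0 x)"
  define g1 where "g1 = (\<lambda>x. indicator K x * g0 x)"
  have f1: "integrable lborel f1"
    unfolding f1_def by (rule L1_loc_integrable_compact[OF L(1) f0 K])
  have g1: "integrable lborel g1"
    unfolding g1_def by (rule L1_loc_integrable_compact[OF L(2) g0 K])
  have weak: "(LINT x|lborel. f1 x * partial_deriv k \<psi> x) = - (LINT x|lborel. g1 x * \<psi> x)"
    if \<psi>: "\<psi> \<in> test_functions (ball x0 (2 * r))" for \<psi>
  proof -
    have \<psi>\<Omega>: "\<psi> \<in> test_functions \<Omega>"
      using test_functions_mono[OF subset_trans[OF ball_subset_cball K(2)[unfolded K_def]]] \<psi>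
      by blast
    have eq: "f1 x * partial_deriv k \<psi> x = f0 x * partial_deriv k \<psi> x" "g1 x * \<psi> x = g0 x * \<psi> x" for x
      using test_function_zero[OF \<psi>, of x] test_function_zero[OF test_function_partial_deriv[OF \<psi>], of x k]
      by (auto simp: f1_def g1_def K_def split: split_indicator)
    have "(LINT x|lborel. f0 x * partial_deriv k \<psi> x) = (LINT x:\<Omega>|lebesgue. f x * partial_deriv k \<psi> x)"
      by (rule L1_loc_test_function(3)[OF L(1) f0 test_function_partial_deriv[OF \<psi>\<Omega>], symmetric])
    moreover have "(LINT x|lborel. g0 x * \<psi> x) = (LINT x:\<Omega>|lebesgue. g x * \<psi> x)"
      by (rule L1_loc_test_function(3)[OF L(2) g0 \<psi>\<Omega>, symmetric])
    ultimately show ?thesis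
      using fg \<psi>\<Omega> by (simp only: eq has_weak_deriv_def) simp
  qed
  have 1: "AE x in lborel. \<forall>n. h n \<le> r \<longrightarrow> x \<in> ball x0 r \<longrightarrow>
      f1 (x + h n *\<^sub>R e) - f1 x = (LINT t|lborel. indicator {0..h n} t * g1 (x + t *\<^sub>R e))"
    unfolding AE_all_countable
  proof
    fix n
    show "AE x in lborel. h n \<le> r \<longrightarrow> x \<in> ball x0 r \<longrightarrow>
      f1 (x + h n *\<^sub>R e) - f1 x = (LINT t|lborel. indicator {0..h n} t * g1 (x + t *\<^sub>R e))"
    proof (cases "h n \<le> r")
      case True
      from weak_deriv_line_integral[OF f1 g1 weak less_imp_le[OF h(1)] True]
      show ?thesis by (rule eventually_mono) (auto simp: e_def)
    qed simp
  qed
  have 2: "AE x in lborel. \<forall>n. x + h n *\<^sub>R e \<in> \<Omega> \<longrightarrow> f (x + h n *\<^sub>R e) = f0 (x + h n *\<^sub>R e)"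
    unfolding AE_all_countable using AE_lborel_shift[OF f0(2)] by blast
  have "AE x in lborel. x \<in> ball x0 r \<longrightarrow> (\<lambda>n. (f (x + h n *\<^sub>R e) - f x) * real (Suc n)) \<longlonglongrightarrow> g x"
    using 1 2 f0(2) g0(2) lebesgue_differentiation_lines[OF g1 h, of e]
  proof eventually_elim
    case (elim x)
    show ?case
    proof
      assume x: "x \<in> ball x0 r"
      then have xK: "x \<in> K" using r by (simp add: K_def)
      then have gx: "g1 x = g x" using elim K by (auto simp: g1_def)
      have "eventually (\<lambda>n. h n < r) sequentially" using order_tendstoD(2)[OF h(2) r] .
      then have "eventually (\<lambda>n. (LINT t|lborel. indicator {0..h n} t * g1 (x + t *\<^sub>R e)) / h n
          = (f (x + h n *\<^sub>R e) - f x) * real (Suc n)) sequentially"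
      proof eventually_elim
        case hn: (elim n)
        have "dist x0 (x + h n *\<^sub>R e) \<le> dist x0 x + norm (h n *\<^sub>R e)"
          using dist_triangle[of x0 "x + h n *\<^sub>R e" x] by (simp add: dist_norm)
        also have "norm (h n *\<^sub>R e) \<le> r" using hn h(1)[of n] by (simp add: e_def)
        finally have xh: "x + h n *\<^sub>R e \<in> K" using x by (simp add: K_def)
        have "(LINT t|lborel. indicator {0..h n} t * g1 (x + t *\<^sub>R e)) = f1 (x + h n *\<^sub>R e) - f1 x"
          using elim(1) hn x by simp
        also have "\<dots> = f (x + h n *\<^sub>R e) - f x"
          using elim xh xK K by (auto simp: f1_def)
        finally show ?case by (simp add: h_def)
      qed
      with elim(5) show "(\<lambda>n. (f (x + h n *\<^sub>R e) - f x) * real (Suc n)) \<longlonglongrightarrow> g x"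
        unfolding gx by (rule Lim_transform_eventually)
    qed
  qed
  then show "\<exists>U. open U \<and> x0 \<in> U \<and> (AE y in lborel. y \<in> U \<longrightarrow>
      (\<lambda>n. (f (y + (1 / real (Suc n)) *\<^sub>R axis k 1) - f y) * real (Suc n)) \<longlonglongrightarrow> g y)"
    using r by (intro exI[of _ "ball x0 r"]) (simp add: h_def e_def)
qed

section \<open>Differentiating an identity between products\<close>

lemma difference_quotient_mult:
  fixes f a :: "'a::real_normed_vector \<Rightarrow> real"
  assumes f: "(\<lambda>n. (f (x + (1 / real (Suc n)) *\<^sub>R e) - f x) * real (Suc n)) \<longlonglongrightarrow> f'"
    and a: "(\<lambda>n. (a (x + (1 / real (Suc n)) *\<^sub>R e) - a x) * real (Suc n)) \<longlonglongrightarrow> a'"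
  shows "(\<lambda>n. (f (x + (1 / real (Suc n)) *\<^sub>R e) * a (x + (1 / real (Suc n)) *\<^sub>R e) - f x * a x) * real (Suc n))
    \<longlonglongrightarrow> f' * a x + f x * a'"
proof -
  define h where "h = (\<lambda>n. 1 / real (Suc n))"
  have "h \<longlonglongrightarrow> 0" using LIMSEQ_inverse_real_of_nat by (simp add: h_def inverse_eq_divide)
  from tendsto_add[OF tendsto_const[of "a x"] tendsto_mult[OF a this]]
  have "(\<lambda>n. a x + (a (x + h n *\<^sub>R e) - a x) * real (Suc n) * h n) \<longlonglongrightarrow> a x"
    by (simp add: h_def)
  moreover have "a x + (a (x + h n *\<^sub>R e) - a x) * real (Suc n) * h n = a (x + h n *\<^sub>R e)" for n
    by (simp add: h_def)
  ultimately have ax: "(\<lambda>n. a (x + h n *\<^sub>R e)) \<longlonglongrightarrow> a x" by simp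
  have "(\<lambda>n. (f (x + h n *\<^sub>R e) - f x) * real (Suc n) * a (x + h n *\<^sub>R e)
      + f x * ((a (x + h n *\<^sub>R e) - a x) * real (Suc n))) \<longlonglongrightarrow> f' * a x + f x * a'"
    using f a ax unfolding h_def by (intro tendsto_intros)
  moreover have "(f (x + h n *\<^sub>R e) - f x) * real (Suc n) * a (x + h n *\<^sub>R e)
      + f x * ((a (x + h n *\<^sub>R e) - a x) * real (Suc n))
      = (f (x + h n *\<^sub>R e) * a (x + h n *\<^sub>R e) - f x * a x) * real (Suc n)" for n
    by (simp add: algebra_simps)
  ultimately show ?thesis by (simp only: h_def)
qed

text \<open>
  A Leibniz rule without any integrability of the products: the two sequences of difference
  quotients coincide for large \<open>n\<close>, because \<open>\<Omega>\<close> is open and the identity survives each of the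
  countably many shifts outside a null set.
\<close>

lemma weak_deriv_of_equal_products:
  fixes f a g b :: "real ^ 'm::finite \<Rightarrow> real"
  assumes \<Omega>: "open \<Omega>"
    and f: "has_weak_deriv \<Omega> [k] f f'" and a: "has_weak_deriv \<Omega> [k] a a'"
    and g: "has_weak_deriv \<Omega> [k] g g'" and b: "has_weak_deriv \<Omega> [k] b b'"
    and eq: "AE x in lborel. x \<in> \<Omega> \<longrightarrow> f x * a x = g x * b x"
  shows "AE x in lborel. x \<in> \<Omega> \<longrightarrow> f' x * a x + f x * a' x = g' x * b x + g x * b' x"
proof -
  define e where "e = (axis k 1 :: real ^ 'm)"
  note dq = weak_deriv_difference_quotient[OF \<Omega>, of k, folded e_def]
  have "AE x in lborel. \<forall>n. x + (1 / real (Suc n)) *\<^sub>R e \<in> \<Omega> \<longrightarrow>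
      f (x + (1 / real (Suc n)) *\<^sub>R e) * a (x + (1 / real (Suc n)) *\<^sub>R e)
      = g (x + (1 / real (Suc n)) *\<^sub>R e) * b (x + (1 / real (Suc n)) *\<^sub>R e)"
    unfolding AE_all_countable using AE_lborel_shift[OF eq] by blast
  with eq dq[OF f] dq[OF a] dq[OF g] dq[OF b] show ?thesis
  proof eventually_elim
    case (elim x)
    show ?case
    proof
      assume x: "x \<in> \<Omega>"
      have "(\<lambda>n. x + (1 / real (Suc n)) *\<^sub>R e) \<longlonglongrightarrow> x + 0 *\<^sub>R e"
        using LIMSEQ_inverse_real_of_nat
        by (intro tendsto_intros) (simp add: inverse_eq_divide)
      then have "eventually (\<lambda>n. x + (1 / real (Suc n)) *\<^sub>R e \<in> \<Omega>) sequentially"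
        using topological_tendstoD[OF _ \<Omega>] x by simp
      then have ev: "eventually (\<lambda>n.
          (f (x + (1 / real (Suc n)) *\<^sub>R e) * a (x + (1 / real (Suc n)) *\<^sub>R e) - f x * a x) * real (Suc n)
          = (g (x + (1 / real (Suc n)) *\<^sub>R e) * b (x + (1 / real (Suc n)) *\<^sub>R e) - g x * b x) * real (Suc n))
          sequentially"
        by (rule eventually_mono) (use elim x in simp)
      have "(\<lambda>n. (g (x + (1 / real (Suc n)) *\<^sub>R e) * b (x + (1 / real (Suc n)) *\<^sub>R e) - g x * b x) * real (Suc n))
          \<longlonglongrightarrow> f' x * a x + f x * a' x"
        by (rule Lim_transform_eventually[OF difference_quotient_mult ev])
           (use elim x in blast)+
      moreover have "(\<lambda>n. (g (x + (1 / real (Suc n)) *\<^sub>R e) * b (x + (1 / real (Suc n)) *\<^sub>R e) - g x * b x) * real (Suc n))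
          \<longlonglongrightarrow> g' x * b x + g x * b' x"
        by (rule difference_quotient_mult) (use elim x in blast)+
      ultimately show "f' x * a x + f x * a' x = g' x * b x + g x * b' x"
        by (rule LIMSEQ_unique)
    qed
  qed
qed

section \<open>The pointwise rank argument\<close>

text \<open>
  For an antisymmetric \<open>M\<close> the relation is \<open>M \<and> w = 0\<close>, which makes the 2-form \<open>M\<close> divisible by \<open>w\<close>. Solving
  for \<open>M\<^sub>i\<^sub>j\<close> with \<open>w\<^sub>k \<noteq> 0\<close> writes row \<open>i\<close> in terms of column \<open>k\<close> and \<open>w\<close>.
\<close>

lemma rank_le_2_of_cyclic_relation:
  fixes M :: "real ^ 'n::finite ^ 'n" and w :: "real ^ 'n"
  assumes w: "w \<noteq> 0"
    and cyc: "\<And>i j k. M $ i $ j * w $ k + M $ j $ k * w $ i + M $ k $ i * w $ j = 0"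
  shows "rank M \<le> 2"
proof -
  obtain k where k: "w $ k \<noteq> 0" using w by (auto simp: vec_eq_iff)
  define c where "c = (\<chi> j. M $ j $ k)"
  have "row i M \<in> span {c, w}" for i
  proof -
    have "row i M = (- w $ i / w $ k) *\<^sub>R c + (- M $ k $ i / w $ k) *\<^sub>R w"
    proof (unfold vec_eq_iff, rule allI)
      fix j
      have "M $ i $ j * w $ k = - (M $ j $ k * w $ i) - M $ k $ i * w $ j"
        using cyc[of i j k] by linarith
      then show "row i M $ j = ((- w $ i / w $ k) *\<^sub>R c + (- M $ k $ i / w $ k) *\<^sub>R w) $ j"
        using k by (simp add: row_def c_def field_simps)
    qed
    then show ?thesis by (simp only:) (intro span_add span_scale span_base; simp)
  qed
  then have "rows M \<subseteq> span {c, w}" by (auto simp: rows_def)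
  then have "dim (rows M) \<le> card {c, w}" by (rule dim_le_card) simp
  also have "\<dots> \<le> 2" by (simp add: card_insert_if)
  finally show ?thesis by (simp add: row_rank_def)
qed

section \<open>Functions in \<open>W\<^sub>0\<close> with vanishing weak derivative\<close>

text \<open>
  A segment of length \<open>2 R\<close> in direction \<open>k\<close> that starts at \<open>x \<in> \<Omega>\<close> ends outside \<open>\<Omega>\<close>, so
  \<open>- \<phi> x\<close> is the integral of \<open>\<partial>\<^sub>k\<phi>\<close> along it.
\<close>

lemma poincare_inequality:
  fixes \<phi> :: "real ^ 'm::finite \<Rightarrow> real"
  assumes \<phi>: "\<phi> \<in> test_functions \<Omega>" and \<Omega>: "\<Omega> \<subseteq> ball 0 R" and R: "R > 0"
  shows "(LINT x|lborel. \<bar>\<phi> x\<bar>) \<le> 2 * R * (LINT x|lborel. \<bar>partial_deriv k \<phi> x\<bar>)"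
proof -
  define e where "e = (axis k 1 :: real ^ 'm)"
  define g where "g = (\<lambda>x. \<bar>partial_deriv k \<phi> x\<bar>)"
  note \<phi>' = test_function_partial_deriv[OF \<phi>, of k]
  have g: "integrable lborel g" unfolding g_def using test_function_integrable[OF \<phi>'] by simp
  have [measurable]: "g \<in> borel_measurable borel" using borel_measurable_integrable[OF g] by simp
  have int: "integrable (lborel \<Otimes>\<^sub>M lborel) (\<lambda>(x, t). indicator {0..2 * R} t * g (x + t *\<^sub>R e))"
    using integrable_line_shift[OF g, of "\<lambda>_. 1" 1 0 "2 * R" e] by simp
  define G where "G = (\<lambda>x. LINT t|lborel. indicator {0..2 * R} t * g (x + t *\<^sub>R e))"
  have G: "integrable lborel G"
    unfolding G_def using lborel_pair.integrable_fst[OF int] .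
  have G0: "G x \<ge> 0" for x
    unfolding G_def by (intro Bochner_Integration.integral_nonneg) (simp add: g_def)
  have le: "\<bar>\<phi> x\<bar> \<le> G x" for x
  proof (cases "x \<in> \<Omega>")
    case True
    have "x + (2 * R) *\<^sub>R e \<notin> \<Omega>"
    proof
      assume "x + (2 * R) *\<^sub>R e \<in> \<Omega>"
      then have "norm (x + (2 * R) *\<^sub>R e) < R" "norm x < R" using \<Omega> True by auto
      moreover have "norm ((2 * R) *\<^sub>R e) \<le> norm (x + (2 * R) *\<^sub>R e) + norm x"
        using norm_triangle_ineq4[of "x + (2 * R) *\<^sub>R e" x] by simp
      moreover have "norm ((2 * R) *\<^sub>R e) = 2 * R" using R by (simp add: e_def)
      ultimately show False by linarith
    qed
    then have "- \<phi> x = (LINT t|lborel. indicator {0..2 * R} t * partial_deriv k \<phi> (x + t *\<^sub>R e))"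
      using test_function_line_integral[OF \<phi>, of "2 * R" k x] test_function_zero[OF \<phi>] R
      by (simp add: e_def)
    then have "\<bar>\<phi> x\<bar> = \<bar>LINT t|lborel. indicator {0..2 * R} t * partial_deriv k \<phi> (x + t *\<^sub>R e)\<bar>"
      by simp
    also have "\<dots> \<le> (LINT t|lborel. \<bar>indicator {0..2 * R} t * partial_deriv k \<phi> (x + t *\<^sub>R e)\<bar>)"
      by (rule integral_abs_bound)
    also have "\<dots> = G x" by (simp add: G_def g_def abs_mult)
    finally show ?thesis .
  qed (use test_function_zero[OF \<phi>] G0 in simp)
  have "(LINT x|lborel. \<bar>\<phi> x\<bar>) \<le> (LINT x|lborel. G x)"
    using test_function_integrable[OF \<phi>] G le by (intro integral_mono) auto
  also have "\<dots> = (LINT t|lborel. LINT x|lborel. indicator {0..2 * R} t * g (x + t *\<^sub>R e))"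
    unfolding G_def using lborel_pair.Fubini_integral[OF int] by simp
  also have "\<dots> = (LINT t|lborel. indicator {0..2 * R} t * (LINT x|lborel. g x))"
    by (simp add: lborel_integral_shift(2))
  also have "\<dots> = 2 * R * (LINT x|lborel. g x)"
    using R by simp
  finally show ?thesis by (simp add: g_def)
qed

lemma set_integrable_lebesgue_cong_AE:
  fixes f g :: "'a::euclidean_space \<Rightarrow> real"
  assumes f: "set_integrable lebesgue \<Omega> f" and ae: "AE x in lborel. x \<in> \<Omega> \<longrightarrow> f x = g x"
  shows "set_integrable lebesgue \<Omega> g"
    and "(LINT x:\<Omega>|lebesgue. f x) = (LINT x:\<Omega>|lebesgue. g x)"
proof -
  have ae': "AE x in lebesgue. indicator \<Omega> x *\<^sub>R f x = indicator \<Omega> x *\<^sub>R g x"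
    using ae unfolding AE_lebesgue_iff
    by (rule eventually_mono) (auto split: split_indicator)
  have m: "(\<lambda>x. indicator \<Omega> x *\<^sub>R f x) \<in> borel_measurable lebesgue"
    using f unfolding set_integrable_def by (rule borel_measurable_integrable)
  note m' = borel_measurable_AE[OF m ae']
  show "set_integrable lebesgue \<Omega> g"
    using f integrable_cong_AE[OF m m' ae'] by (simp add: set_integrable_def)
  show "(LINT x:\<Omega>|lebesgue. f x) = (LINT x:\<Omega>|lebesgue. g x)"
    using integral_cong_AE[OF m m' ae'] by (simp add: set_lebesgue_integral_def)
qed

lemma test_function_set_integral_abs:
  assumes \<phi>: "\<phi> \<in> test_functions \<Omega>"
  shows "set_integrable lebesgue \<Omega> (\<lambda>x. \<bar>\<phi> x\<bar>)"
    and "(LINT x:\<Omega>|lebesgue. \<bar>\<phi> x\<bar>) = (LINT x|lborel. \<bar>\<phi> x\<bar>)"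
proof -
  have eq: "indicator \<Omega> x *\<^sub>R \<bar>\<phi> x\<bar> = \<bar>\<phi> x\<bar>" for x
    using test_function_zero[OF \<phi>, of x] by (auto split: split_indicator)
  have m: "(\<lambda>x. \<bar>\<phi> x\<bar>) \<in> borel_measurable borel" using test_function_borel[OF \<phi>] by simp
  have i: "integrable lborel (\<lambda>x. \<bar>\<phi> x\<bar>)" using test_function_integrable[OF \<phi>] by simp
  show "set_integrable lebesgue \<Omega> (\<lambda>x. \<bar>\<phi> x\<bar>)"
    unfolding set_integrable_def eq
    using lebesgue_integral_borel_representative(1)[OF m, of "\<lambda>x. \<bar>\<phi> x\<bar>"] i by simp
  show "(LINT x:\<Omega>|lebesgue. \<bar>\<phi> x\<bar>) = (LINT x|lborel. \<bar>\<phi> x\<bar>)"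
    unfolding set_lebesgue_integral_def eq
    using lebesgue_integral_borel_representative(2)[OF m, of "\<lambda>x. \<bar>\<phi> x\<bar>"] by simp
qed

lemma W1_space_has_weak_deriv:
  assumes "u \<in> W1_space k \<Omega>" "length is \<le> k"
  shows "has_weak_deriv \<Omega> is u (weak_deriv \<Omega> is u)"
  using assms by (auto simp: W1_space_def W_space_def intro: has_weak_deriv_weak_deriv)

lemma weak_deriv_Nil_AE:
  assumes "open \<Omega>" "u \<in> W1_space k \<Omega>"
  shows "AE x in lborel. x \<in> \<Omega> \<longrightarrow> weak_deriv \<Omega> [] u x = u x"
  using has_weak_deriv_unique[OF assms(1) W1_space_has_weak_deriv[OF assms(2)] has_weak_deriv_Nil] assms(2)
  by (auto simp: W1_space_def W_space_def)

text \<open>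
  For approximating test functions \<open>\<phi> n\<close>, the derivatives \<open>\<partial>\<^sub>i(\<phi> n)\<close> tend to 0 in \<open>L\<^sup>1\<close>, hence by the
  Poincare inequality so do the \<open>\<phi> n\<close> themselves.
\<close>

lemma W1_0_space_eq_0:
  fixes w :: "real ^ 'm::finite \<Rightarrow> real"
  assumes \<Omega>: "open \<Omega>" "bounded \<Omega>" and w: "w \<in> W1_0_space k \<Omega>" "1 \<le> k"
    and dw: "AE x in lborel. x \<in> \<Omega> \<longrightarrow> weak_deriv \<Omega> [i] w x = 0"
  shows "AE x in lborel. x \<in> \<Omega> \<longrightarrow> w x = 0"
proof -
  let ?w = "weak_deriv \<Omega> [] w"
  have W: "w \<in> W1_space k \<Omega>" using w by (simp add: W1_0_space_def)
  obtain \<phi> where \<phi>: "\<And>n. \<phi> n \<in> test_functions \<Omega>"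
    and lim: "\<And>is. length is \<le> k \<Longrightarrow>
      (\<lambda>n. LINT x:\<Omega>|lebesgue. \<bar>partial_derivs is (\<phi> n) x - weak_deriv \<Omega> is w x\<bar>) \<longlonglongrightarrow> 0"
    using w by (auto simp: W1_0_space_def)
  obtain R where R: "R > 0" "\<Omega> \<subseteq> ball 0 R"
    using bounded_subset_ballD[OF \<Omega>(2), of 0] by blast
  have wi: "set_integrable lebesgue \<Omega> ?w"
    using W by (simp add: W1_space_def L1_space_def)
  have "(LINT x:\<Omega>|lebesgue. \<bar>partial_derivs [i] (\<phi> n) x - weak_deriv \<Omega> [i] w x\<bar>)
      = (LINT x|lborel. \<bar>partial_deriv i (\<phi> n) x\<bar>)" for n
  proof -
    note \<phi>' = test_function_partial_deriv[OF \<phi>[of n], of i]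
    have "(LINT x:\<Omega>|lebesgue. \<bar>partial_deriv i (\<phi> n) x\<bar>)
        = (LINT x:\<Omega>|lebesgue. \<bar>partial_derivs [i] (\<phi> n) x - weak_deriv \<Omega> [i] w x\<bar>)"
      by (rule set_integrable_lebesgue_cong_AE(2)[OF test_function_set_integral_abs(1)[OF \<phi>']])
         (use dw in \<open>auto elim!: eventually_mono\<close>)
    then show ?thesis using test_function_set_integral_abs(2)[OF \<phi>'] by simp
  qed
  then have "(\<lambda>n. LINT x|lborel. \<bar>partial_deriv i (\<phi> n) x\<bar>) \<longlonglongrightarrow> 0"
    using lim[of "[i]"] w(2) by simp
  then have l1: "(\<lambda>n. 2 * R * (LINT x|lborel. \<bar>partial_deriv i (\<phi> n) x\<bar>)) \<longlonglongrightarrow> 2 * R * 0"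
    by (intro tendsto_intros)
  have l2: "(\<lambda>n. LINT x:\<Omega>|lebesgue. \<bar>\<phi> n x - ?w x\<bar>) \<longlonglongrightarrow> 0" using lim[of "[]"] by simp
  have "(LINT x:\<Omega>|lebesgue. \<bar>?w x\<bar>) \<le> (LINT x:\<Omega>|lebesgue. \<bar>\<phi> n x - ?w x\<bar>)
      + 2 * R * (LINT x|lborel. \<bar>partial_deriv i (\<phi> n) x\<bar>)" for n
  proof -
    have \<phi>i: "set_integrable lebesgue \<Omega> (\<phi> n)"
      using L1_loc_test_function_integrable[OF \<Omega>(1) _ \<phi>[of n], of "\<lambda>_. 1"]
      by (simp add: L1_loc_def absolutely_integrable_on_const lmeasurable_compact)
    have d: "set_integrable lebesgue \<Omega> (\<lambda>x. \<bar>\<phi> n x - ?w x\<bar>)"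
      by (intro set_integrable_abs set_integral_diff(1) \<phi>i wi)
    have "(LINT x:\<Omega>|lebesgue. \<bar>?w x\<bar>) \<le> (LINT x:\<Omega>|lebesgue. \<bar>\<phi> n x - ?w x\<bar> + \<bar>\<phi> n x\<bar>)"
      by (intro set_integral_mono set_integrable_abs wi set_integral_add(1) d \<phi>i) auto
    also have "\<dots> = (LINT x:\<Omega>|lebesgue. \<bar>\<phi> n x - ?w x\<bar>) + (LINT x:\<Omega>|lebesgue. \<bar>\<phi> n x\<bar>)"
      by (intro set_integral_add(2) d set_integrable_abs \<phi>i)
    also have "(LINT x:\<Omega>|lebesgue. \<bar>\<phi> n x\<bar>) = (LINT x|lborel. \<bar>\<phi> n x\<bar>)"
      by (rule test_function_set_integral_abs(2)[OF \<phi>])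
    also have "\<dots> \<le> 2 * R * (LINT x|lborel. \<bar>partial_deriv i (\<phi> n) x\<bar>)"
      by (rule poincare_inequality[OF \<phi> R(2,1)])
    finally show ?thesis by simp
  qed
  moreover have "(\<lambda>n. (LINT x:\<Omega>|lebesgue. \<bar>\<phi> n x - ?w x\<bar>)
      + 2 * R * (LINT x|lborel. \<bar>partial_deriv i (\<phi> n) x\<bar>)) \<longlonglongrightarrow> 0"
    using tendsto_add[OF l2 l1] by simp
  ultimately have "(LINT x:\<Omega>|lebesgue. \<bar>?w x\<bar>) \<le> 0"
    by (intro LIMSEQ_le_const) auto
  then have "(LINT x|lebesgue. \<bar>indicator \<Omega> x *\<^sub>R ?w x\<bar>) \<le> 0"
    by (simp add: set_lebesgue_integral_def abs_mult)
  moreover have "0 \<le> (LINT x|lebesgue. \<bar>indicator \<Omega> x *\<^sub>R ?w x\<bar>)"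
    by (intro Bochner_Integration.integral_nonneg) simp
  ultimately have "(LINT x|lebesgue. \<bar>indicator \<Omega> x *\<^sub>R ?w x\<bar>) = 0" by (rule antisym)
  moreover have "integrable lebesgue (\<lambda>x. \<bar>indicator \<Omega> x *\<^sub>R ?w x\<bar>)"
    using wi unfolding set_integrable_def by (rule integrable_abs)
  ultimately have "AE x in lebesgue. \<bar>indicator \<Omega> x *\<^sub>R ?w x\<bar> = 0"
    by (subst (asm) integral_nonneg_eq_0_iff_AE) auto
  then have "AE x in lborel. x \<in> \<Omega> \<longrightarrow> ?w x = 0"
    unfolding AE_lebesgue_iff by (rule eventually_mono) (auto split: split_indicator_asm)
  with weak_deriv_Nil_AE[OF \<Omega>(1) W] show ?thesis
    by eventually_elim auto
qed

section \<open>Convexity: the two gradients are parallel\<close>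

lemma W1_space_L1:
  assumes "open \<Omega>" "u \<in> W1_space k \<Omega>"
  shows "set_integrable lebesgue \<Omega> u"
  using set_integrable_lebesgue_cong_AE(1)[OF _ weak_deriv_Nil_AE[OF assms]] assms(2)
  by (auto simp: W1_space_def L1_space_def)

lemma W1_space_linear:
  assumes \<Omega>: "open \<Omega>" and u: "u \<in> W1_space k \<Omega>" and v: "v \<in> W1_space k \<Omega>"
  shows "(\<lambda>x. a * u x + b * v x) \<in> W1_space k \<Omega>"
    and "length is \<le> k \<Longrightarrow> AE x in lborel. x \<in> \<Omega> \<longrightarrow>
      weak_deriv \<Omega> is (\<lambda>x. a * u x + b * v x) x = a * weak_deriv \<Omega> is u x + b * weak_deriv \<Omega> is v x"
proof -
  have D: "has_weak_deriv \<Omega> is (\<lambda>x. a * u x + b * v x)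
      (\<lambda>x. a * weak_deriv \<Omega> is u x + b * weak_deriv \<Omega> is v x)" if "length is \<le> k" for "is"
    by (rule has_weak_deriv_linear[OF \<Omega> W1_space_has_weak_deriv[OF u that] W1_space_has_weak_deriv[OF v that]])
  have ae: "AE x in lborel. x \<in> \<Omega> \<longrightarrow>
      a * weak_deriv \<Omega> is u x + b * weak_deriv \<Omega> is v x = weak_deriv \<Omega> is (\<lambda>x. a * u x + b * v x) x"
    if "length is \<le> k" for "is"
    by (rule has_weak_deriv_unique[OF \<Omega> D[OF that] has_weak_deriv_weak_deriv[OF D[OF that]]])
  have "set_integrable lebesgue \<Omega> (\<lambda>x. a * weak_deriv \<Omega> is u x + b * weak_deriv \<Omega> is v x)"
    if "length is \<le> k" for "is"
    using u v that
    by (intro set_integral_add(1) set_integrable_mult_right) (auto simp: W1_space_def L1_space_def)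
  from set_integrable_lebesgue_cong_AE(1)[OF this ae]
  have "weak_deriv \<Omega> is (\<lambda>x. a * u x + b * v x) \<in> L1_space \<Omega>" if "length is \<le> k" for "is"
    using that by (simp add: L1_space_def)
  moreover have "(\<lambda>x. a * u x + b * v x) \<in> L1_loc \<Omega>"
    using u v by (intro L1_loc_linear) (auto simp: W1_space_def W_space_def)
  ultimately show "(\<lambda>x. a * u x + b * v x) \<in> W1_space k \<Omega>"
    using D by (auto simp: W1_space_def W_space_def)
  show "AE x in lborel. x \<in> \<Omega> \<longrightarrow>
      weak_deriv \<Omega> is (\<lambda>x. a * u x + b * v x) x = a * weak_deriv \<Omega> is u x + b * weak_deriv \<Omega> is v x"
    if "length is \<le> k"
    using ae[OF that] by eventually_elim auto
qed

lemma W1_space_mono: "j \<le> k \<Longrightarrow> W1_space k \<Omega> \<subseteq> W1_space j \<Omega>"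
  by (auto simp: W1_space_def W_space_def)

lemma W1_0_space_cmult:
  fixes w :: "real ^ 'm::finite \<Rightarrow> real"
  assumes \<Omega>: "open \<Omega>" and w: "w \<in> W1_0_space k \<Omega>" and jk: "j \<le> k"
  shows "(\<lambda>x. c * w x) \<in> W1_0_space j \<Omega>"
proof -
  have W: "w \<in> W1_space j \<Omega>" using w W1_space_mono[OF jk] by (auto simp: W1_0_space_def)
  have cW: "(\<lambda>x. c * w x) \<in> W1_space j \<Omega>" using W1_space_linear(1)[OF \<Omega> W W, of c 0] by simp
  obtain \<phi> where \<phi>: "\<And>n. \<phi> n \<in> test_functions \<Omega>"
    and lim: "\<And>is. length is \<le> k \<Longrightarrow>
      (\<lambda>n. LINT x:\<Omega>|lebesgue. \<bar>partial_derivs is (\<phi> n) x - weak_deriv \<Omega> is w x\<bar>) \<longlonglongrightarrow> 0"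
    using w by (auto simp: W1_0_space_def)
  have "(\<lambda>n. LINT x:\<Omega>|lebesgue. \<bar>partial_derivs is (\<lambda>x. c * \<phi> n x) x - weak_deriv \<Omega> is (\<lambda>x. c * w x) x\<bar>)
      \<longlonglongrightarrow> 0" if len: "length is \<le> j" for "is"
  proof -
    have ae: "AE x in lborel. x \<in> \<Omega> \<longrightarrow> weak_deriv \<Omega> is (\<lambda>x. c * w x) x = c * weak_deriv \<Omega> is w x"
      using W1_space_linear(2)[OF \<Omega> W W len, of c 0] by simp
    have eq: "(LINT x:\<Omega>|lebesgue. \<bar>partial_derivs is (\<lambda>x. c * \<phi> n x) x - weak_deriv \<Omega> is (\<lambda>x. c * w x) x\<bar>)
        = \<bar>c\<bar> * (LINT x:\<Omega>|lebesgue. \<bar>partial_derivs is (\<phi> n) x - weak_deriv \<Omega> is w x\<bar>)" for n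
    proof -
      have i1: "set_integrable lebesgue \<Omega> (partial_derivs is (\<phi> n))"
        using L1_loc_test_function_integrable[OF \<Omega> _ test_function_partial_derivs[OF \<phi>[of n]], of "\<lambda>_. 1" "is"]
        by (simp add: L1_loc_def absolutely_integrable_on_const lmeasurable_compact)
      have i2: "set_integrable lebesgue \<Omega> (weak_deriv \<Omega> is w)"
        using W len by (simp add: W1_space_def L1_space_def)
      have "set_integrable lebesgue \<Omega> (\<lambda>x. \<bar>c\<bar> * \<bar>partial_derivs is (\<phi> n) x - weak_deriv \<Omega> is w x\<bar>)"
        by (intro set_integrable_mult_right set_integrable_abs set_integral_diff(1) i1 i2)
      moreover have "AE x in lborel. x \<in> \<Omega> \<longrightarrow> \<bar>c\<bar> * \<bar>partial_derivs is (\<phi> n) x - weak_deriv \<Omega> is w x\<bar>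
          = \<bar>partial_derivs is (\<lambda>x. c * \<phi> n x) x - weak_deriv \<Omega> is (\<lambda>x. c * w x) x\<bar>"
        using ae by (rule eventually_mono)
          (simp add: partial_derivs_cmult[OF \<phi>] abs_mult[symmetric] right_diff_distrib)
      ultimately have "(LINT x:\<Omega>|lebesgue. \<bar>c\<bar> * \<bar>partial_derivs is (\<phi> n) x - weak_deriv \<Omega> is w x\<bar>)
          = (LINT x:\<Omega>|lebesgue. \<bar>partial_derivs is (\<lambda>x. c * \<phi> n x) x - weak_deriv \<Omega> is (\<lambda>x. c * w x) x\<bar>)"
        by (rule set_integrable_lebesgue_cong_AE(2))
      then show ?thesis by simp
    qed
    have "(\<lambda>n. \<bar>c\<bar> * (LINT x:\<Omega>|lebesgue. \<bar>partial_derivs is (\<phi> n) x - weak_deriv \<Omega> is w x\<bar>)) \<longlonglongrightarrow> \<bar>c\<bar> * 0"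
      using lim[of "is"] len jk by (intro tendsto_intros) auto
    then show ?thesis unfolding eq by simp
  qed
  then show ?thesis
    using cW test_function_cmult[OF \<phi>] unfolding W1_0_space_def mem_Collect_eq
    by (intro conjI exI[of _ "\<lambda>n x. c * \<phi> n x"]) auto
qed

lemma set_integrable_norm_vec:
  fixes f :: "'a::euclidean_space \<Rightarrow> real ^ 'm::finite"
  assumes "\<And>i. set_integrable lebesgue \<Omega> (\<lambda>x. f x $ i)"
  shows "set_integrable lebesgue \<Omega> (\<lambda>x. norm (f x))"
proof -
  have "integrable lebesgue (\<lambda>x. \<Sum>i\<in>UNIV. (indicator \<Omega> x *\<^sub>R f x $ i) *\<^sub>R axis i (1::real))"
    using assms unfolding set_integrable_def
    by (intro Bochner_Integration.integrable_sum integrable_scaleR_left) auto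
  moreover have "(\<Sum>i\<in>UNIV. (indicator \<Omega> x *\<^sub>R f x $ i) *\<^sub>R axis i (1::real)) = indicator \<Omega> x *\<^sub>R f x" for x
    using basis_expansion[of "f x"]
    by (simp add: scalar_mult_eq_scaleR scaleR_sum_right[symmetric] flip: scaleR_scaleR)
  ultimately have "integrable lebesgue (\<lambda>x. norm (indicator \<Omega> x *\<^sub>R f x))"
    by (simp only: integrable_norm)
  then show ?thesis by (simp add: set_integrable_def)
qed

lemma Linf_mult_integrable:
  assumes \<Omega>: "open \<Omega>" and H: "H \<in> Linf_space \<Omega>" and u: "set_integrable lebesgue \<Omega> u"
  shows "set_integrable lebesgue \<Omega> (\<lambda>x. H x * u x)"
proof -
  obtain B where B: "AE x in lborel. x \<in> \<Omega> \<longrightarrow> \<bar>H x\<bar> \<le> B"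
    using H AE_lebesgue_on_iff[OF \<Omega>] by (auto simp: Linf_space_def)
  have "\<Omega> \<in> sets lebesgue" using \<Omega> by (simp add: sets_completionI_sets)
  then have mH: "(\<lambda>x. indicator \<Omega> x *\<^sub>R H x) \<in> borel_measurable lebesgue"
    using H by (subst borel_measurable_restrict_space_iff[symmetric]) (auto simp: Linf_space_def)
  have iu: "integrable lebesgue (\<lambda>x. indicator \<Omega> x *\<^sub>R u x)" using u by (simp add: set_integrable_def)
  have eq: "indicator \<Omega> x *\<^sub>R (H x * u x) = (indicator \<Omega> x *\<^sub>R H x) * (indicator \<Omega> x *\<^sub>R u x)" for x
    by (simp split: split_indicator)
  show ?thesis
    unfolding set_integrable_def eq
  proof (rule Bochner_Integration.integrable_bound)
    show "integrable lebesgue (\<lambda>x. B * (indicator \<Omega> x *\<^sub>R u x))" using iu by simp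
    show "(\<lambda>x. (indicator \<Omega> x *\<^sub>R H x) * (indicator \<Omega> x *\<^sub>R u x)) \<in> borel_measurable lebesgue"
      by (rule borel_measurable_times[OF mH borel_measurable_integrable[OF iu]])
    have "AE x in lebesgue. x \<in> \<Omega> \<longrightarrow> \<bar>H x\<bar> \<le> B" using B by (simp only: AE_lebesgue_iff)
    then show "AE x in lebesgue. norm ((indicator \<Omega> x *\<^sub>R H x) * (indicator \<Omega> x *\<^sub>R u x))
        \<le> norm (B * (indicator \<Omega> x *\<^sub>R u x))"
      by (rule eventually_mono) (auto simp: abs_mult intro!: mult_right_mono split: split_indicator)
  qed
qed

text \<open>
  The midpoint of \<open>u\<close> and \<open>v\<close> is an admissible competitor for both minimizers. The terms with \<open>H\<close>
  cancel in the sum of the two inequalities, which leaves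
  \<open>\<integral>\<^sub>\<Omega> (\<bar>\<alpha>\<bar> + \<bar>\<beta>\<bar> - \<bar>\<alpha> + \<beta>\<bar>) \<le> 0\<close> with a nonnegative integrand.
\<close>

lemma minimizers_gradients_parallel:
  fixes F :: "real ^ 'm::finite \<Rightarrow> real ^ 'm"
  assumes \<Omega>: "open \<Omega>" and F: "\<And>i. (\<lambda>x. F x $ i) \<in> L1_space \<Omega>" and H: "H \<in> Linf_space \<Omega>"
    and u: "p_area_minimizer \<Omega> F H u" and v: "p_area_minimizer \<Omega> F H v"
    and uv: "(\<lambda>x. u x - v x) \<in> W1_0_space k \<Omega>" and k: "1 \<le> k"
  shows "AE x in lborel. x \<in> \<Omega> \<longrightarrow>
    norm (weak_grad \<Omega> u x + F x) + norm (weak_grad \<Omega> v x + F x)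
      = norm ((weak_grad \<Omega> u x + F x) + (weak_grad \<Omega> v x + F x))"
proof -
  define \<alpha> where "\<alpha> = (\<lambda>x. weak_grad \<Omega> u x + F x)"
  define \<beta> where "\<beta> = (\<lambda>x. weak_grad \<Omega> v x + F x)"
  define m where "m = (\<lambda>x. 1/2 * u x + 1/2 * v x)"
  have U: "u \<in> W1_space 1 \<Omega>" and V: "v \<in> W1_space 1 \<Omega>"
    using u v by (auto simp: p_area_minimizer_def)
  have m1: "(\<lambda>x. u x + (- 1/2) * (u x - v x)) = m" and m2: "(\<lambda>x. v x + 1/2 * (u x - v x)) = m"
    by (auto simp: m_def fun_eq_iff field_simps)
  have pu: "p_area \<Omega> F H u \<le> p_area \<Omega> F H m"
    using bspec[OF conjunct2[OF u[unfolded p_area_minimizer_def]] W1_0_space_cmult[OF \<Omega> uv k, of "- 1/2"]]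
    by (simp only: m1)
  have pv: "p_area \<Omega> F H v \<le> p_area \<Omega> F H m"
    using bspec[OF conjunct2[OF v[unfolded p_area_minimizer_def]] W1_0_space_cmult[OF \<Omega> uv k, of "1/2"]]
    by (simp only: m2)
  have di: "set_integrable lebesgue \<Omega> (weak_deriv \<Omega> [i] w)" if "w \<in> W1_space 1 \<Omega>" for w i
    using that by (simp add: W1_space_def L1_space_def)
  have Fi: "set_integrable lebesgue \<Omega> (\<lambda>x. F x $ i)" for i
    using F by (simp add: L1_space_def)
  have \<alpha>i: "set_integrable lebesgue \<Omega> (\<lambda>x. \<alpha> x $ i)" for i
    using di[OF U] Fi by (simp add: \<alpha>_def weak_grad_def)
  have \<beta>i: "set_integrable lebesgue \<Omega> (\<lambda>x. \<beta> x $ i)" for i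
    using di[OF V] Fi by (simp add: \<beta>_def weak_grad_def)
  have a: "set_integrable lebesgue \<Omega> (\<lambda>x. norm (\<alpha> x))" by (rule set_integrable_norm_vec[OF \<alpha>i])
  have b: "set_integrable lebesgue \<Omega> (\<lambda>x. norm (\<beta> x))" by (rule set_integrable_norm_vec[OF \<beta>i])
  have ab: "set_integrable lebesgue \<Omega> (\<lambda>x. norm (\<alpha> x + \<beta> x))"
    using \<alpha>i \<beta>i by (intro set_integrable_norm_vec) simp
  have Hu: "set_integrable lebesgue \<Omega> (\<lambda>x. H x * u x)"
    by (rule Linf_mult_integrable[OF \<Omega> H W1_space_L1[OF \<Omega> U]])
  have Hv: "set_integrable lebesgue \<Omega> (\<lambda>x. H x * v x)"
    by (rule Linf_mult_integrable[OF \<Omega> H W1_space_L1[OF \<Omega> V]])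
  have "AE x in lborel. \<forall>i. x \<in> \<Omega> \<longrightarrow>
      weak_deriv \<Omega> [i] m x = 1/2 * weak_deriv \<Omega> [i] u x + 1/2 * weak_deriv \<Omega> [i] v x"
    unfolding m_def AE_all_countable using W1_space_linear(2)[OF \<Omega> U V, of "[_]" "1/2" "1/2"] by simp
  then have grad: "AE x in lborel. x \<in> \<Omega> \<longrightarrow> norm (weak_grad \<Omega> m x + F x) = 1/2 * norm (\<alpha> x + \<beta> x)"
  proof eventually_elim
    case (elim x)
    show ?case
    proof
      assume "x \<in> \<Omega>"
      then have "weak_grad \<Omega> m x + F x = (1/2) *\<^sub>R (\<alpha> x + \<beta> x)"
        using elim by (simp add: vec_eq_iff weak_grad_def \<alpha>_def \<beta>_def field_simps)
      then show "norm (weak_grad \<Omega> m x + F x) = 1/2 * norm (\<alpha> x + \<beta> x)" by simp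
    qed
  qed
  have "set_integrable lebesgue \<Omega> (\<lambda>x. 1/2 * norm (\<alpha> x + \<beta> x) + 1/2 * (H x * u x + H x * v x))"
    by (intro set_integral_add(1) set_integrable_mult_right ab Hu Hv)
  moreover have "AE x in lborel. x \<in> \<Omega> \<longrightarrow>
      1/2 * norm (\<alpha> x + \<beta> x) + 1/2 * (H x * u x + H x * v x) = norm (weak_grad \<Omega> m x + F x) + H x * m x"
    using grad by (rule eventually_mono) (simp add: m_def algebra_simps)
  ultimately have "p_area \<Omega> F H m
      = (LINT x:\<Omega>|lebesgue. 1/2 * norm (\<alpha> x + \<beta> x) + 1/2 * (H x * u x + H x * v x))"
    unfolding p_area_def by (rule set_integrable_lebesgue_cong_AE(2)[symmetric])
  also have "\<dots> = 1/2 * (LINT x:\<Omega>|lebesgue. norm (\<alpha> x + \<beta> x))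
      + 1/2 * ((LINT x:\<Omega>|lebesgue. H x * u x) + (LINT x:\<Omega>|lebesgue. H x * v x))"
    by (simp add: set_integral_add ab Hu Hv)
  finally have pm: "2 * p_area \<Omega> F H m = (LINT x:\<Omega>|lebesgue. norm (\<alpha> x + \<beta> x))
      + ((LINT x:\<Omega>|lebesgue. H x * u x) + (LINT x:\<Omega>|lebesgue. H x * v x))" by simp
  have pu': "p_area \<Omega> F H u = (LINT x:\<Omega>|lebesgue. norm (\<alpha> x)) + (LINT x:\<Omega>|lebesgue. H x * u x)"
    unfolding p_area_def \<alpha>_def[symmetric] using a Hu by (simp add: \<alpha>_def)
  have pv': "p_area \<Omega> F H v = (LINT x:\<Omega>|lebesgue. norm (\<beta> x)) + (LINT x:\<Omega>|lebesgue. H x * v x)"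
    unfolding p_area_def using b Hv by (simp add: \<beta>_def)
  define d where "d = (\<lambda>x. norm (\<alpha> x) + norm (\<beta> x) - norm (\<alpha> x + \<beta> x))"
  have d: "set_integrable lebesgue \<Omega> d"
    unfolding d_def by (intro set_integral_diff(1) set_integral_add(1) a b ab)
  have d0: "0 \<le> indicator \<Omega> x *\<^sub>R d x" for x
    using norm_triangle_ineq[of "\<alpha> x" "\<beta> x"] by (simp add: d_def)
  have "(LINT x:\<Omega>|lebesgue. d x) \<le> 0"
    using pu pv pm pu' pv' a b ab by (simp add: d_def set_integral_diff set_integral_add)
  moreover have "0 \<le> (LINT x:\<Omega>|lebesgue. d x)"
    unfolding set_lebesgue_integral_def by (intro Bochner_Integration.integral_nonneg d0)
  ultimately have "(LINT x|lebesgue. indicator \<Omega> x *\<^sub>R d x) = 0"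
    by (simp add: set_lebesgue_integral_def)
  then have "AE x in lebesgue. indicator \<Omega> x *\<^sub>R d x = 0"
    using d d0 unfolding set_integrable_def by (subst (asm) integral_nonneg_eq_0_iff_AE) auto
  then show ?thesis
    unfolding AE_lebesgue_iff
    by (rule eventually_mono) (auto simp: d_def \<alpha>_def \<beta>_def split: split_indicator_asm)
qed

section \<open>Uniqueness of minimizers\<close>

theorem mainTheorem4:
  fixes \<Omega> :: "(real ^ 'm::finite) set"
    and F :: "real ^ 'm \<Rightarrow> real ^ 'm"
    and H u v :: "real ^ 'm \<Rightarrow> real"
    and C :: real
  assumes "open \<Omega>" and "connected \<Omega>" and "\<Omega> \<noteq> {}" and "bounded \<Omega>"
    and "\<And>i. (\<lambda>x. F x $ i) \<in> W_space 1 \<Omega> \<inter> L1_space \<Omega>"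
    and "H \<in> Linf_space \<Omega>"
    and "u \<in> W1_space 2 \<Omega>" and "v \<in> W1_space 2 \<Omega>"
    and "p_area_minimizer \<Omega> F H u" and "p_area_minimizer \<Omega> F H v"
    and "(\<lambda>x. u x - v x) \<in> W1_0_space 2 \<Omega>"
    and "C > 0"
    and "AE x in lebesgue_on \<Omega>. norm (weak_grad \<Omega> u x + F x) \<ge> C"
    and "AE x in lebesgue_on \<Omega>. norm (weak_grad \<Omega> v x + F x) \<ge> C"
    and "AE x in lebesgue_on \<Omega>.
           3 \<le> rank (curl_matrix \<Omega> F x) \<and> rank (curl_matrix \<Omega> F x) \<le> CARD('m)"
  shows "AE x in lebesgue_on \<Omega>. u x = v x"
proof -
  note \<Omega> = assms(1) and F = assms(5) and U = assms(7) and V = assms(8)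
  define D where "D = (\<lambda>i w. weak_deriv \<Omega> [i] w)"
  define D2 where "D2 = (\<lambda>i j w. weak_deriv \<Omega> [i, j] w)"
  define \<alpha> where "\<alpha> = (\<lambda>i x. D i u x + F x $ i)"
  define w where "w = (\<lambda>i x. D i u x - D i v x)"
  have step: "has_weak_deriv \<Omega> [k] (D i z) (D2 i k z)" if "z \<in> W1_space 2 \<Omega>" for z i k
    unfolding D_def D2_def
    by (rule has_weak_deriv_step; rule W1_space_has_weak_deriv[OF that]) simp_all
  have sym: "AE x in lborel. \<forall>i k. x \<in> \<Omega> \<longrightarrow> D2 i k z x = D2 k i z x"
    if z: "z \<in> W1_space 2 \<Omega>" for z
  proof -
    have "AE x in lborel. x \<in> \<Omega> \<longrightarrow> D2 i k z x = D2 k i z x" for i k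
      unfolding D2_def
      by (rule has_weak_deriv_unique[OF \<Omega> _ has_weak_deriv_commute]; rule W1_space_has_weak_deriv[OF z]) simp_all
    then show ?thesis unfolding AE_all_countable by blast
  qed
  have Fk: "has_weak_deriv \<Omega> [k] (\<lambda>x. F x $ i) (weak_deriv \<Omega> [k] (\<lambda>x. F x $ i))" for i k
  proof -
    have "\<exists>g. has_weak_deriv \<Omega> [k] (\<lambda>x. F x $ i) g"
      using F[of i] by (auto simp: W_space_def dest: spec[of _ "[k]"])
    then show ?thesis by (blast intro: has_weak_deriv_weak_deriv)
  qed
  have \<alpha>k: "has_weak_deriv \<Omega> [k] (\<alpha> i) (\<lambda>x. D2 i k u x + weak_deriv \<Omega> [k] (\<lambda>x. F x $ i) x)" for i k
    unfolding \<alpha>_def by (rule has_weak_deriv_add[OF \<Omega> step[OF U] Fk])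
  have wk: "has_weak_deriv \<Omega> [k] (w i) (\<lambda>x. D2 i k u x - D2 i k v x)" for i k
    unfolding w_def by (rule has_weak_deriv_diff[OF \<Omega> step[OF U] step[OF V]])
  have "AE x in lborel. x \<in> \<Omega> \<longrightarrow>
      norm (weak_grad \<Omega> u x + F x) + norm (weak_grad \<Omega> v x + F x)
      = norm ((weak_grad \<Omega> u x + F x) + (weak_grad \<Omega> v x + F x))"
    using F by (intro minimizers_gradients_parallel[OF \<Omega> _ assms(6,9,10,11)]) auto
  then have par: "AE x in lborel. x \<in> \<Omega> \<longrightarrow> \<alpha> i x * w j x = \<alpha> j x * w i x" for i j
  proof eventually_elim
    case (elim x)
    show ?case
    proof
      assume "x \<in> \<Omega>"
      let ?a = "weak_grad \<Omega> u x + F x" and ?b = "weak_grad \<Omega> v x + F x"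
      have eq: "norm ?a *\<^sub>R ?b = norm ?b *\<^sub>R ?a"
        using elim \<open>x \<in> \<Omega>\<close> by (simp only: norm_triangle_eq[symmetric])
      have c: "?a $ l = \<alpha> l x" "?b $ l = \<alpha> l x - w l x" for l
        by (simp_all add: weak_grad_def \<alpha>_def w_def D_def)
      show "\<alpha> i x * w j x = \<alpha> j x * w i x"
      proof (cases "?a = 0")
        case True
        then have "\<alpha> l x = 0" for l using c(1)[of l] by simp
        then show ?thesis by simp
      next
        case False
        have e: "norm ?a * (\<alpha> l x - w l x) = norm ?b * \<alpha> l x" for l
          using arg_cong[OF eq, of "\<lambda>z. z $ l"] by (simp only: vector_scaleR_component c real_scaleR_def)
        have "norm ?a * (\<alpha> i x * (\<alpha> j x - w j x)) = norm ?a * (\<alpha> j x * (\<alpha> i x - w i x))"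
          using e[of i] e[of j] by (simp only: mult.left_commute[of "norm ?a"]) simp
        then have "\<alpha> i x * (\<alpha> j x - w j x) = \<alpha> j x * (\<alpha> i x - w i x)"
          using False by simp
        then show ?thesis by (simp add: algebra_simps)
      qed
    qed
  qed
  have "AE x in lborel. x \<in> \<Omega> \<longrightarrow>
      (D2 i k u x + weak_deriv \<Omega> [k] (\<lambda>x. F x $ i) x) * w j x + \<alpha> i x * (D2 j k u x - D2 j k v x)
      = (D2 j k u x + weak_deriv \<Omega> [k] (\<lambda>x. F x $ j) x) * w i x + \<alpha> j x * (D2 i k u x - D2 i k v x)" for i j k
    by (rule weak_deriv_of_equal_products[OF \<Omega> \<alpha>k wk \<alpha>k wk par])
  then have diff: "AE x in lborel. \<forall>i j k. x \<in> \<Omega> \<longrightarrow>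
      (D2 i k u x + weak_deriv \<Omega> [k] (\<lambda>x. F x $ i) x) * w j x + \<alpha> i x * (D2 j k u x - D2 j k v x)
      = (D2 j k u x + weak_deriv \<Omega> [k] (\<lambda>x. F x $ j) x) * w i x + \<alpha> j x * (D2 i k u x - D2 i k v x)"
    unfolding AE_all_countable by blast
  have rk: "AE x in lborel. x \<in> \<Omega> \<longrightarrow> 3 \<le> rank (curl_matrix \<Omega> F x)"
    using assms(15) unfolding AE_lebesgue_on_iff[OF \<Omega>] by (rule eventually_mono) simp
  have "AE x in lborel. x \<in> \<Omega> \<longrightarrow> (\<chi> i. w i x) = 0"
    using diff sym[OF U] sym[OF V] rk
  proof eventually_elim
    case (elim x)
    show ?case
    proof (rule impI, rule ccontr)
      assume x: "x \<in> \<Omega>" and w0: "(\<chi> i. w i x) \<noteq> 0"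
      let ?M = "curl_matrix \<Omega> F x"
      \<comment> \<open>Summing the differentiated identity cyclically cancels the terms with \<open>\<alpha>\<close> (they contain the
        symmetric second derivatives of \<open>u - v\<close>) and antisymmetrizes the derivatives of \<open>F\<close>.\<close>
      have cyc: "?M $ i $ j * w k x + ?M $ j $ k * w i x + ?M $ k $ i * w j x = 0" for i j k
      proof -
        define f where "f = (\<lambda>k i. weak_deriv \<Omega> [k] (\<lambda>x. F x $ i) x)"
        define p where "p = (\<lambda>i k. D2 i k u x)"
        define q where "q = (\<lambda>i k. D2 i k v x)"
        have E: "(p i k + f k i) * w j x + \<alpha> i x * (p j k - q j k)
            = (p j k + f k j) * w i x + \<alpha> j x * (p i k - q i k)" for i j k
          using elim(1) x by (simp add: f_def p_def q_def)
        have S: "p i k = p k i" "q i k = q k i" for i k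
          using elim(2,3) x by (simp_all add: p_def q_def)
        have "(f i j - f j i) * w k x + (f j k - f k j) * w i x + (f k i - f i k) * w j x = 0"
          using E[of i j k] E[of j k i] E[of k i j] S[of i j] S[of j k] S[of k i]
          by (simp add: algebra_simps)
        then show ?thesis by (simp add: curl_matrix_def f_def)
      qed
      have "rank ?M \<le> 2"
        by (rule rank_le_2_of_cyclic_relation[OF w0]) (simp add: cyc)
      moreover have "3 \<le> rank ?M" using elim(4) x by blast
      ultimately show False by simp
    qed
  qed
  then have w0: "AE x in lborel. x \<in> \<Omega> \<longrightarrow> w i x = 0" for i
    by (rule eventually_mono) (simp add: vec_eq_iff)
  have "AE x in lborel. x \<in> \<Omega> \<longrightarrow> weak_deriv \<Omega> [i] (\<lambda>x. u x - v x) x = 0" for i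
  proof -
    have "AE x in lborel. x \<in> \<Omega> \<longrightarrow> weak_deriv \<Omega> [i] (\<lambda>x. u x - v x) x = w i x"
      using W1_space_linear(2)[OF \<Omega> U V, of "[i]" 1 "-1"] by (simp add: w_def D_def)
    with w0[of i] show ?thesis by eventually_elim simp
  qed
  from W1_0_space_eq_0[OF \<Omega> assms(4,11) _ this]
  show ?thesis unfolding AE_lebesgue_on_iff[OF \<Omega>] by simp
qed

end
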